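(* Let $X$ be a Tychonoff space and $p,q\in\{a,\sigma,\tau,R,\beta,d\}$. (i) $X$ is universally $P_{[p,q]}$-measurable (i.e. $P_p(X)$ is a $C$-embedded subset of $P_q(X)$) if and only if $X$ is universally $M^+_{[p,q]}$-measurable (i.e. $M^+_p(X)$ is a $C$-embedded subset of $M^+_q(X)$). (ii) $X$ is universally $P^\ast_{[p,q]}$-measurable (i.e. $P_p(X)$ is a $C^\ast$-embedded subset of $P_q(X)$) if and only if $X$ is universally $M^{+\ast}_{[p,q]}$-measurable (i.e. $M^+_p(X)$ is a $C^\ast$-embedded subset of $M^+_q(X)$).
   Context: $\beta X$ is the Stone–Čech compactification. For a compact Hausdorff space $K$, $M(K)$ is the dual of the Banach space $C(K)$ of real continuous functions with the sup-norm, taken with the weak$^\ast$ topology; its elements are identified with finite signed regular Borel measures on $K$. $M^+(K)$ is the set of nonnegative elements of $M(K)$, and $P(K)=\{\mu\in M^+(K):\mu(K)=1\}$. $|\mu|$ is the total variation. For a Tychonoff space $X$ define the following subsets of $M(\beta X)$. $M_d(X)$: those $\mu$ concentrated on some countable subset of $X$; $M_\beta(X)$: those $\mu$ concentrated on some compact subset of $X$; $M_R(X)$: those $\mu$ concentrated on some $\sigma$-compact subset of $X$; $M_\tau(X)$: those $\mu$ with $|\mu|(K)=0$ for all compact $K\subset\beta X\setminus X$; $M_\sigma(X)$: those $\mu$ with $|\mu|(K)=0$ for all compact $K\subset\beta X\setminus X$ of type $G_\delta$ in $\beta X$; $M_a(X)=M(\beta X)$. Here "$\mu$ is concentrated on $S$"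 means $|\mu|(\beta X\setminus S)=0$. For each index $p$: $M^+_p(X)=M_p(X)\cap M^+(\beta X)$ and $P_p(X)=M_p(X)\cap P(\beta X)$. All these carry the subspace topology from $M(\beta X)$. A subset $A$ of a space $Z$ is $C$-embedded (resp. $C^\ast$-embedded) in $Z$ if every real continuous (resp. every bounded real continuous) function on $A$ extends to a continuous function on $Z$; in particular these notions presuppose $A\subset Z$. *)

theory Defs
  imports "HOL-Analysis.Analysis"
begin

section \<open>The Stone--Cech compactification\<close>

text \<open>The compactification of \<open>X\<close> is the closure of the canonical image of \<open>X\<close> in the cube
  indexed by all continuous functions from \<open>X\<close> to the unit interval. Index functions are normalised
  outside \<open>topspace X\<close>, so that each continuous function occurs exactly once.\<close>

definition unit_functions :: "'a topology \<Rightarrow> ('a \<Rightarrow> real) set" where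
  "unit_functions X =
     {f \<in> extensional (topspace X). continuous_map X (top_of_set {0..1}) f}"

definition unit_cube :: "'a topology \<Rightarrow> (('a \<Rightarrow> real) \<Rightarrow> real) topology" where
  "unit_cube X = product_topology (\<lambda>f. top_of_set {0..1}) (unit_functions X)"

definition sc_embed :: "'a topology \<Rightarrow> 'a \<Rightarrow> ('a \<Rightarrow> real) \<Rightarrow> real" where
  "sc_embed X x = (\<lambda>f\<in>unit_functions X. f x)"

definition stone_cech :: "'a topology \<Rightarrow> (('a \<Rightarrow> real) \<Rightarrow> real) topology" where
  "stone_cech X =
     subtopology (unit_cube X) (unit_cube X closure_of (sc_embed X ` topspace X))"


section \<open>Signed regular Borel measures and the weak* topology\<close>

definition borel_sets :: "'b topology \<Rightarrow> 'b set set" where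
  "borel_sets K = sigma_sets (topspace K) {U. openin K U}"

text \<open>A finite signed Borel measure is a real-valued set function; it is set to \<open>0\<close> on
  non-Borel sets, so that equal measures are equal as functions.\<close>

definition signed_measure :: "'b topology \<Rightarrow> ('b set \<Rightarrow> real) \<Rightarrow> bool" where
  "signed_measure K \<mu> \<longleftrightarrow>
     \<mu> {} = 0 \<and>
     (\<forall>A :: nat \<Rightarrow> 'b set. range A \<subseteq> borel_sets K \<and> disjoint_family A \<longrightarrow>
        (\<lambda>n. \<mu> (A n)) sums \<mu> (\<Union>n. A n)) \<and>
     (\<forall>E. E \<notin> borel_sets K \<longrightarrow> \<mu> E = 0)"

text \<open>Jordan decomposition: \<open>\<mu>\<^sup>+(E) = sup {\<mu>(A) : A \<subseteq> E Borel}\<close>, \<open>\<mu>\<^sup>- = (-\<mu>)\<^sup>+\<close> and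
  \<open>|\<mu>| = \<mu>\<^sup>+ + \<mu>\<^sup>-\<close>. In the supremum the function \<open>ennreal\<close> truncates negative values to \<open>0\<close>,
  which is harmless because \<open>A = {}\<close> contributes \<open>0\<close>.\<close>

definition pos_variation :: "'b topology \<Rightarrow> ('b set \<Rightarrow> real) \<Rightarrow> 'b set \<Rightarrow> ennreal" where
  "pos_variation K \<mu> E = (SUP A\<in>{A \<in> borel_sets K. A \<subseteq> E}. ennreal (\<mu> A))"

definition neg_variation :: "'b topology \<Rightarrow> ('b set \<Rightarrow> real) \<Rightarrow> 'b set \<Rightarrow> ennreal" where
  "neg_variation K \<mu> = pos_variation K (\<lambda>E. - \<mu> E)"

definition total_variation :: "'b topology \<Rightarrow> ('b set \<Rightarrow> real) \<Rightarrow> 'b set \<Rightarrow> ennreal" where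
  "total_variation K \<mu> E = pos_variation K \<mu> E + neg_variation K \<mu> E"

definition regular_measure :: "'b topology \<Rightarrow> ('b set \<Rightarrow> real) \<Rightarrow> bool" where
  "regular_measure K \<mu> \<longleftrightarrow>
     (\<forall>E\<in>borel_sets K.
        total_variation K \<mu> E = (SUP C\<in>{C. compactin K C \<and> C \<subseteq> E}. total_variation K \<mu> C) \<and>
        total_variation K \<mu> E = (INF U\<in>{U. openin K U \<and> E \<subseteq> U}. total_variation K \<mu> U))"

definition radon_measures :: "'b topology \<Rightarrow> ('b set \<Rightarrow> real) set" where
  "radon_measures K = {\<mu>. signed_measure K \<mu> \<and> regular_measure K \<mu>}"

definition signed_integral :: "'b topology \<Rightarrow> ('b set \<Rightarrow> real) \<Rightarrow> ('b \<Rightarrow> real) \<Rightarrow> real" where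
  "signed_integral K \<mu> f =
     integral\<^sup>L (measure_of (topspace K) (borel_sets K) (pos_variation K \<mu>)) f -
     integral\<^sup>L (measure_of (topspace K) (borel_sets K) (neg_variation K \<mu>)) f"

text \<open>The weak* topology on \<open>M(K) = C(K)*\<close>, an element of which acts on \<open>C(K)\<close> by integration:
  it is the initial topology for the maps \<open>\<mu> \<mapsto> \<integral> f d\<mu>\<close>, where \<open>f\<close> ranges over \<open>C(K)\<close>.\<close>

definition weak_star :: "'b topology \<Rightarrow> ('b set \<Rightarrow> real) topology" where
  "weak_star K =
     pullback_topology (radon_measures K)
       (\<lambda>\<mu>. \<lambda>f\<in>{f. continuous_map K euclideanreal f}. signed_integral K \<mu> f)
       (product_topology (\<lambda>f. euclideanreal) {f. continuous_map K euclideanreal f})"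

definition pos_measures :: "'b topology \<Rightarrow> ('b set \<Rightarrow> real) set" where
  "pos_measures K = {\<mu> \<in> radon_measures K. \<forall>E\<in>borel_sets K. 0 \<le> \<mu> E}"

definition prob_measures :: "'b topology \<Rightarrow> ('b set \<Rightarrow> real) set" where
  "prob_measures K = {\<mu> \<in> pos_measures K. \<mu> (topspace K) = 1}"

definition concentrated_on :: "'b topology \<Rightarrow> ('b set \<Rightarrow> real) \<Rightarrow> 'b set \<Rightarrow> bool" where
  "concentrated_on K \<mu> S \<longleftrightarrow> total_variation K \<mu> (topspace K - S) = 0"


section \<open>Classes of measures on a Tychonoff space\<close>

definition sigma_compact_in :: "'a topology \<Rightarrow> 'a set \<Rightarrow> bool" where
  "sigma_compact_in X S \<longleftrightarrow> (\<exists>C :: nat \<Rightarrow> 'a set. (\<forall>n. compactin X (C n)) \<and> S = (\<Union>n. C n))"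

datatype measure_class = Class_a | Class_sigma | Class_tau | Class_R | Class_beta | Class_d

text \<open>The space \<open>X\<close> is identified with its image under \<open>sc_embed X\<close>.\<close>

fun class_measures ::
  "measure_class \<Rightarrow> 'a topology \<Rightarrow> ((('a \<Rightarrow> real) \<Rightarrow> real) set \<Rightarrow> real) set" where
  "class_measures Class_a X = radon_measures (stone_cech X)"
| "class_measures Class_sigma X =
     {\<mu> \<in> radon_measures (stone_cech X).
        \<forall>C. compactin (stone_cech X) C \<and> gdelta_in (stone_cech X) C \<and>
            C \<subseteq> topspace (stone_cech X) - sc_embed X ` topspace X
          \<longrightarrow> total_variation (stone_cech X) \<mu> C = 0}"
| "class_measures Class_tau X =
     {\<mu> \<in> radon_measures (stone_cech X).
        \<forall>C. compactin (stone_cech X) C \<and>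
            C \<subseteq> topspace (stone_cech X) - sc_embed X ` topspace X
          \<longrightarrow> total_variation (stone_cech X) \<mu> C = 0}"
| "class_measures Class_R X =
     {\<mu> \<in> radon_measures (stone_cech X).
        \<exists>S. sigma_compact_in X S \<and> concentrated_on (stone_cech X) \<mu> (sc_embed X ` S)}"
| "class_measures Class_beta X =
     {\<mu> \<in> radon_measures (stone_cech X).
        \<exists>S. compactin X S \<and> concentrated_on (stone_cech X) \<mu> (sc_embed X ` S)}"
| "class_measures Class_d X =
     {\<mu> \<in> radon_measures (stone_cech X).
        \<exists>S. countable S \<and> S \<subseteq> topspace X \<and> concentrated_on (stone_cech X) \<mu> (sc_embed X ` S)}"

definition class_pos :: "measure_class \<Rightarrow> 'a topology \<Rightarrow> ((('a \<Rightarrow> real) \<Rightarrow> real) set \<Rightarrow> real) set" where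
  "class_pos p X = class_measures p X \<inter> pos_measures (stone_cech X)"

definition class_prob :: "measure_class \<Rightarrow> 'a topology \<Rightarrow> ((('a \<Rightarrow> real) \<Rightarrow> real) set \<Rightarrow> real) set" where
  "class_prob p X = class_measures p X \<inter> prob_measures (stone_cech X)"


section \<open>Embeddings and universal measurability\<close>

definition C_embedded :: "'b topology \<Rightarrow> 'b set \<Rightarrow> bool" where
  "C_embedded Z A \<longleftrightarrow> A \<subseteq> topspace Z \<and>
     (\<forall>f. continuous_map (subtopology Z A) euclideanreal f \<longrightarrow>
        (\<exists>g. continuous_map Z euclideanreal g \<and> (\<forall>x\<in>A. g x = f x)))"

definition Cstar_embedded :: "'b topology \<Rightarrow> 'b set \<Rightarrow> bool" where
  "Cstar_embedded Z A \<longleftrightarrow> A \<subseteq> topspace Z \<and>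
     (\<forall>f. continuous_map (subtopology Z A) euclideanreal f \<and> bounded (f ` A) \<longrightarrow>
        (\<exists>g. continuous_map Z euclideanreal g \<and> (\<forall>x\<in>A. g x = f x)))"

definition universally_P_measurable ::
  "measure_class \<Rightarrow> measure_class \<Rightarrow> 'a topology \<Rightarrow> bool" where
  "universally_P_measurable p q X \<longleftrightarrow>
     C_embedded (subtopology (weak_star (stone_cech X)) (class_prob q X)) (class_prob p X)"

definition universally_Mpos_measurable ::
  "measure_class \<Rightarrow> measure_class \<Rightarrow> 'a topology \<Rightarrow> bool" where
  "universally_Mpos_measurable p q X \<longleftrightarrow>
     C_embedded (subtopology (weak_star (stone_cech X)) (class_pos q X)) (class_pos p X)"

definition universally_Pstar_measurable ::
  "measure_class \<Rightarrow> measure_class \<Rightarrow> 'a topology \<Rightarrow> bool" where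
  "universally_Pstar_measurable p q X \<longleftrightarrow>
     Cstar_embedded (subtopology (weak_star (stone_cech X)) (class_prob q X)) (class_prob p X)"

definition universally_Mposstar_measurable ::
  "measure_class \<Rightarrow> measure_class \<Rightarrow> 'a topology \<Rightarrow> bool" where
  "universally_Mposstar_measurable p q X \<longleftrightarrow>
     Cstar_embedded (subtopology (weak_star (stone_cech X)) (class_pos q X)) (class_pos p X)"

end

theory Submission
  imports Defs
begin

text \<open>Up to the zero measure, \<open>M\<^sub>p\<^sup>+(X)\<close> is the product of \<open>P\<^sub>p(X)\<close> and a half-line. Normalisation of
  mass gives a retraction of \<open>M\<^sub>p\<^sup>+(X)\<close> onto \<open>P\<^sub>p(X)\<close>, so embeddings pass from cones to
  probability measures.

  For the converse, \<open>P\<^sub>p(X)\<close> is dense in \<open>P\<^sub>q(X)\<close>, since it contains the finite convex combinations of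
  point masses. If \<open>P\<^sub>p(X)\<close> is \<open>C\<close>-embedded, it meets every nonempty zero set of \<open>P\<^sub>q(X)\<close>; hence for \<open>f\<close>
  continuous on \<open>M\<^sub>p\<^sup>+(X)\<close> the functions \<open>t \<mapsto> f (t \<nu>)\<close> converge uniformly on compact subsets of
  the half-line as \<open>\<nu>\<close> tends to a point of \<open>P\<^sub>q(X)\<close>, and \<open>f\<close> extends pointwise to \<open>M\<^sub>q\<^sup>+(X)\<close>. The zero
  measure causes no trouble because it belongs to both cones.

  For \<open>C\<^sup>*\<close>-embeddings one shows that \<open>P\<^sub>p(X)\<close> is even \<open>C\<close>-embedded: if \<open>f\<close> tends to infinity at a
  point, then, as traces of convex neighbourhoods on \<open>P\<^sub>p(X)\<close> are connected, the bounded function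
  \<open>sin \<circ> f\<close> oscillates at that point and has no continuous extension.\<close>

section \<open>Positive Borel measures\<close>

lemma borel_sets_sigma_algebra: "sigma_algebra (topspace K) (borel_sets K)"
  unfolding borel_sets_def
  by (rule sigma_algebra_sigma_sets) (auto dest: openin_subset)

lemma borel_sets_empty [simp]: "{} \<in> borel_sets K"
  unfolding borel_sets_def by (rule sigma_sets.Empty)

lemma borel_sets_openin: "openin K U \<Longrightarrow> U \<in> borel_sets K"
  unfolding borel_sets_def by (auto intro: sigma_sets.Basic)

lemma borel_sets_topspace [simp]: "topspace K \<in> borel_sets K"
  by (simp add: borel_sets_openin)

lemma borel_sets_Diff: "A \<in> borel_sets K \<Longrightarrow> B \<in> borel_sets K \<Longrightarrow> A - B \<in> borel_sets K"
  using borel_sets_sigma_algebra[of K] sigma_algebra.axioms(1) algebra.axioms(1)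
    ring_of_sets.Diff by metis

lemma borel_sets_closedin: "closedin K C \<Longrightarrow> C \<in> borel_sets K"
  by (metis borel_sets_Diff borel_sets_openin borel_sets_topspace closedin_def double_diff order_refl)

lemma borel_sets_compactin: "Hausdorff_space K \<Longrightarrow> compactin K C \<Longrightarrow> C \<in> borel_sets K"
  by (simp add: borel_sets_closedin compactin_imp_closedin)

lemma borel_sets_subset: "E \<in> borel_sets K \<Longrightarrow> E \<subseteq> topspace K"
  unfolding borel_sets_def by (rule sigma_sets_into_sp) (auto dest: openin_subset)

lemma sigma_sets_borel_sets [simp]: "sigma_sets (topspace K) (borel_sets K) = borel_sets K"
  using borel_sets_sigma_algebra sigma_algebra.sigma_sets_eq by blast

section \<open>Nonnegative set functions as measures; variation and regularity\<close>

definition pos_signed_measure :: "'b topology \<Rightarrow> ('b set \<Rightarrow> real) \<Rightarrow> bool" where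
  "pos_signed_measure K \<mu> \<longleftrightarrow> signed_measure K \<mu> \<and> (\<forall>E\<in>borel_sets K. 0 \<le> \<mu> E)"

text \<open>Passing to the type \<open>measure\<close> makes monotonicity, integration and
  almost-everywhere arguments available for these set functions.\<close>

definition borel_measure :: "'b topology \<Rightarrow> ('b set \<Rightarrow> real) \<Rightarrow> 'b measure" where
  "borel_measure K \<mu> = measure_of (topspace K) (borel_sets K) (\<lambda>E. ennreal (\<mu> E))"

lemma borel_sets_Pow: "borel_sets K \<subseteq> Pow (topspace K)"
  using borel_sets_subset by blast

lemma sets_borel_measure [simp]: "sets (borel_measure K \<mu>) = borel_sets K"
  unfolding borel_measure_def using borel_sets_Pow[of K] by simp

lemma space_borel_measure [simp]: "space (borel_measure K \<mu>) = topspace K"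
  unfolding borel_measure_def using borel_sets_Pow[of K] by simp

lemma emeasure_borel_measure:
  assumes "pos_signed_measure K \<mu>" "E \<in> borel_sets K"
  shows "emeasure (borel_measure K \<mu>) E = ennreal (\<mu> E)"
  unfolding borel_measure_def
proof (rule emeasure_measure_of_sigma)
  show "sigma_algebra (topspace K) (borel_sets K)" by (rule borel_sets_sigma_algebra)
  show "positive (borel_sets K) (\<lambda>E. ennreal (\<mu> E))"
    using assms by (simp add: positive_def pos_signed_measure_def signed_measure_def)
  show "countably_additive (borel_sets K) (\<lambda>E. ennreal (\<mu> E))"
    unfolding countably_additive_def
  proof (intro allI impI)
    fix A :: "nat \<Rightarrow> _"
    assume A: "range A \<subseteq> borel_sets K" "disjoint_family A"
    with assms have "(\<lambda>n. \<mu> (A n)) sums \<mu> (\<Union>n. A n)" "\<And>n. 0 \<le> \<mu> (A n)"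
      by (auto simp: pos_signed_measure_def signed_measure_def)
    then show "(\<Sum>i. ennreal (\<mu> (A i))) = ennreal (\<mu> (\<Union> (range A)))"
      by (intro suminf_ennreal_eq) auto
  qed
  show "E \<in> borel_sets K" by fact
qed

lemma finite_measure_borel_measure:
  "pos_signed_measure K \<mu> \<Longrightarrow> finite_measure (borel_measure K \<mu>)"
  by (intro finite_measureI) (simp add: emeasure_borel_measure)

lemma measure_borel_measure:
  "pos_signed_measure K \<mu> \<Longrightarrow> E \<in> borel_sets K \<Longrightarrow> measure (borel_measure K \<mu>) E = \<mu> E"
  by (simp add: measure_def emeasure_borel_measure pos_signed_measure_def)

lemma pos_signed_measure_mono:
  assumes "pos_signed_measure K \<mu>" "A \<in> borel_sets K" "B \<in> borel_sets K" "A \<subseteq> B"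
  shows "\<mu> A \<le> \<mu> B"
  using finite_measure.finite_measure_mono[OF finite_measure_borel_measure[OF assms(1)], of A B]
    assms by (simp add: measure_borel_measure)

lemma pos_variation_pos:
  assumes "pos_signed_measure K \<mu>" "E \<in> borel_sets K"
  shows "pos_variation K \<mu> E = ennreal (\<mu> E)"
  unfolding pos_variation_def
proof (rule antisym)
  show "(SUP A\<in>{A \<in> borel_sets K. A \<subseteq> E}. ennreal (\<mu> A)) \<le> ennreal (\<mu> E)"
    using assms by (auto intro!: SUP_least ennreal_leI pos_signed_measure_mono)
  show "ennreal (\<mu> E) \<le> (SUP A\<in>{A \<in> borel_sets K. A \<subseteq> E}. ennreal (\<mu> A))"
    using assms by (auto intro!: SUP_upper)
qed

lemma neg_variation_pos:
  assumes "pos_signed_measure K \<mu>"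
  shows "neg_variation K \<mu> E = 0"
proof -
  have "neg_variation K \<mu> E \<le> 0"
    unfolding neg_variation_def pos_variation_def
    using assms by (intro SUP_least) (simp add: pos_signed_measure_def ennreal_neg)
  then show ?thesis by simp
qed

lemma total_variation_pos:
  assumes "pos_signed_measure K \<mu>" "E \<in> borel_sets K"
  shows "total_variation K \<mu> E = ennreal (\<mu> E)"
  using assms by (simp add: total_variation_def pos_variation_pos neg_variation_pos)

text \<open>The set \<open>E\<close> is arbitrary: the variations are suprema over Borel subsets, so
  nullity can be tested on those. In this form it passes at once to subsets of \<open>E\<close> and
  to nonnegative combinations of measures.\<close>

lemma total_variation_eq_0_iff:
  assumes "pos_signed_measure K \<mu>"
  shows "total_variation K \<mu> E = 0 \<longleftrightarrow> (\<forall>A\<in>borel_sets K. A \<subseteq> E \<longrightarrow> \<mu> A = 0)"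
proof -
  have "total_variation K \<mu> E = 0 \<longleftrightarrow> pos_variation K \<mu> E \<le> 0"
    using assms by (simp add: total_variation_def neg_variation_pos)
  also have "\<dots> \<longleftrightarrow> (\<forall>A\<in>borel_sets K. A \<subseteq> E \<longrightarrow> ennreal (\<mu> A) \<le> 0)"
    unfolding pos_variation_def SUP_le_iff by blast
  also have "\<dots> \<longleftrightarrow> (\<forall>A\<in>borel_sets K. A \<subseteq> E \<longrightarrow> \<mu> A = 0)"
    using assms unfolding pos_signed_measure_def
    by (metis ennreal_eq_0_iff le_zero_eq order_antisym order_refl)
  finally show ?thesis .
qed

text \<open>The negative variation vanishes identically, so the subtracted integral is taken with
  respect to the zero measure.\<close>

lemma signed_integral_pos:
  assumes "pos_signed_measure K \<mu>"
  shows "signed_integral K \<mu> f = integral\<^sup>L (borel_measure K \<mu>) f"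
proof -
  have 1: "measure_of (topspace K) (borel_sets K) (pos_variation K \<mu>) = borel_measure K \<mu>"
    unfolding borel_measure_def
    by (rule measure_of_eq) (use assms borel_sets_Pow in \<open>auto simp: pos_variation_pos\<close>)
  have "measure_of (topspace K) (borel_sets K) (neg_variation K \<mu>) = borel_measure K (\<lambda>_. 0)"
    unfolding borel_measure_def
    by (rule measure_of_eq) (use assms borel_sets_Pow in \<open>auto simp: neg_variation_pos\<close>)
  moreover have "integral\<^sup>L (borel_measure K (\<lambda>_. 0)) f = 0"
  proof (rule integral_eq_zero_AE)
    have "emeasure (borel_measure K (\<lambda>_. 0)) (topspace K) = 0"
      by (subst emeasure_borel_measure) (auto simp: pos_signed_measure_def signed_measure_def)
    then show "AE x in borel_measure K (\<lambda>_. 0). f x = 0"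
      by (intro AE_I[where N="topspace K"]) auto
  qed
  ultimately show ?thesis unfolding signed_integral_def 1 by simp
qed

text \<open>All values are finite, so inner and outer approximation merge into one condition on the
  gap between an open and a compact set. Unlike the supremum and infimum formulas, this condition is
  easy to verify for combinations of measures.\<close>

lemma regular_measure_pos_iff:
  assumes \<mu>: "pos_signed_measure K \<mu>" and K: "Hausdorff_space K"
  shows "regular_measure K \<mu> \<longleftrightarrow>
    (\<forall>E\<in>borel_sets K. \<forall>e>0. \<exists>C U. compactin K C \<and> C \<subseteq> E \<and> openin K U \<and> E \<subseteq> U \<and> \<mu> U - \<mu> C < e)"
    (is "?L \<longleftrightarrow> ?R")
proof -
  have tvC: "total_variation K \<mu> C = ennreal (\<mu> C)" if "compactin K C" for C
    using that K \<mu> by (simp add: total_variation_pos borel_sets_compactin)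
  have tvU: "total_variation K \<mu> U = ennreal (\<mu> U)" if "openin K U" for U
    using that \<mu> by (simp add: total_variation_pos borel_sets_openin)
  have nn: "0 \<le> \<mu> E" if "E \<in> borel_sets K" for E
    using that \<mu> by (simp add: pos_signed_measure_def)
  show ?thesis
  proof
    assume L: ?L
    show ?R
    proof (intro ballI allI impI)
      fix E and e :: real assume E: "E \<in> borel_sets K" and e: "e > 0"
      have inn: "ennreal (\<mu> E) = (SUP C\<in>{C. compactin K C \<and> C \<subseteq> E}. total_variation K \<mu> C)"
       and out: "ennreal (\<mu> E) = (INF U\<in>{U. openin K U \<and> E \<subseteq> U}. total_variation K \<mu> U)"
        using L E \<mu> unfolding regular_measure_def by (metis total_variation_pos)+
      obtain C where C: "compactin K C" "C \<subseteq> E" "\<mu> E - e/2 < \<mu> C"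
      \<comment> \<open>A negative bound would be truncated by \<open>ennreal\<close>; in that case
        the empty set already serves as \<open>C\<close>.\<close>
      proof (cases "\<mu> E - e/2 < 0")
        case True
        moreover have "\<mu> {} = 0" using \<mu> by (simp add: pos_signed_measure_def signed_measure_def)
        ultimately show ?thesis using that[of "{}"] by simp
      next
        case False
        then have "ennreal (\<mu> E - e/2) < (SUP C\<in>{C. compactin K C \<and> C \<subseteq> E}. total_variation K \<mu> C)"
          using e by (subst inn[symmetric]) (simp add: ennreal_less_iff)
        then obtain C where "compactin K C" "C \<subseteq> E" "ennreal (\<mu> E - e/2) < total_variation K \<mu> C"
          unfolding less_SUP_iff by blast
        then show ?thesis using that[of C] False
          by (simp add: tvC ennreal_less_iff)
      qed
      have "(INF U\<in>{U. openin K U \<and> E \<subseteq> U}. total_variation K \<mu> U) < ennreal (\<mu> E + e/2)"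
        using e nn[OF E] by (subst out[symmetric]) (simp add: ennreal_less_iff)
      then obtain U where U: "openin K U" "E \<subseteq> U" "total_variation K \<mu> U < ennreal (\<mu> E + e/2)"
        unfolding INF_less_iff by blast
      then have "\<mu> U < \<mu> E + e/2"
        by (simp add: tvU ennreal_less_iff nn borel_sets_openin)
      then show "\<exists>C U. compactin K C \<and> C \<subseteq> E \<and> openin K U \<and> E \<subseteq> U \<and> \<mu> U - \<mu> C < e"
        using C U(1,2) by (intro exI[of _ C] exI[of _ U]) auto
    qed
  next
    assume R: ?R
    show ?L
      unfolding regular_measure_def
    proof (intro ballI conjI)
      fix E assume E: "E \<in> borel_sets K"
      note tE = total_variation_pos[OF \<mu> E]
      have approx: "\<exists>C U. compactin K C \<and> C \<subseteq> E \<and> openin K U \<and> E \<subseteq> U \<and>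
          \<mu> E \<le> \<mu> C + e \<and> \<mu> U \<le> \<mu> E + e" if e: "e > 0" for e
      proof -
        obtain C U where CU: "compactin K C" "C \<subseteq> E" "openin K U" "E \<subseteq> U" "\<mu> U - \<mu> C < e"
          using R[rule_format, OF E e] by (elim exE conjE) (rule that)
        moreover have "\<mu> C \<le> \<mu> E" "\<mu> E \<le> \<mu> U"
          using pos_signed_measure_mono[OF \<mu> borel_sets_compactin[OF K CU(1)] E]
            pos_signed_measure_mono[OF \<mu> E borel_sets_openin[OF CU(3)]] CU by blast+
        ultimately show ?thesis by (intro exI[of _ C] exI[of _ U]) auto
      qed
      show "total_variation K \<mu> E = (SUP C\<in>{C. compactin K C \<and> C \<subseteq> E}. total_variation K \<mu> C)"
      proof (rule antisym)
        show "(SUP C\<in>{C. compactin K C \<and> C \<subseteq> E}. total_variation K \<mu> C) \<le> total_variation K \<mu> E"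
          unfolding tE using pos_signed_measure_mono[OF \<mu> borel_sets_compactin[OF K] E]
          by (auto intro!: SUP_least ennreal_leI simp: tvC)
        show "total_variation K \<mu> E \<le> (SUP C\<in>{C. compactin K C \<and> C \<subseteq> E}. total_variation K \<mu> C)"
        proof (rule ennreal_le_epsilon)
          fix e :: real assume "0 < e"
          then obtain C where C: "compactin K C" "C \<subseteq> E" "\<mu> E \<le> \<mu> C + e" using approx by blast
          have "total_variation K \<mu> E \<le> ennreal (\<mu> C) + ennreal e"
            unfolding tE using C \<open>0 < e\<close> nn[OF borel_sets_compactin[OF K C(1)]]
            by (simp add: ennreal_leI flip: ennreal_plus)
          also have "\<dots> \<le> (SUP C\<in>{C. compactin K C \<and> C \<subseteq> E}. total_variation K \<mu> C) + ennreal e"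
            using C by (intro add_right_mono) (auto intro!: SUP_upper2[of C] simp: tvC)
          finally show "total_variation K \<mu> E \<le> (SUP C\<in>{C. compactin K C \<and> C \<subseteq> E}. total_variation K \<mu> C) + ennreal e" .
        qed
      qed
      show "total_variation K \<mu> E = (INF U\<in>{U. openin K U \<and> E \<subseteq> U}. total_variation K \<mu> U)"
      proof (rule antisym)
        show "total_variation K \<mu> E \<le> (INF U\<in>{U. openin K U \<and> E \<subseteq> U}. total_variation K \<mu> U)"
          unfolding tE using pos_signed_measure_mono[OF \<mu> E borel_sets_openin]
          by (auto intro!: INF_greatest ennreal_leI simp: tvU)
        show "(INF U\<in>{U. openin K U \<and> E \<subseteq> U}. total_variation K \<mu> U) \<le> total_variation K \<mu> E"
        proof (rule ennreal_le_epsilon)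
          fix e :: real assume "0 < e"
          then obtain U where U: "openin K U" "E \<subseteq> U" "\<mu> U \<le> \<mu> E + e" using approx by blast
          have "(INF U\<in>{U. openin K U \<and> E \<subseteq> U}. total_variation K \<mu> U) \<le> ennreal (\<mu> U)"
            using U by (auto intro!: INF_lower2[of U] simp: tvU)
          also have "\<dots> \<le> total_variation K \<mu> E + ennreal e"
            unfolding tE using U \<open>0 < e\<close> nn[OF E]
            by (simp add: ennreal_leI flip: ennreal_plus)
          finally show "(INF U\<in>{U. openin K U \<and> E \<subseteq> U}. total_variation K \<mu> U) \<le> total_variation K \<mu> E + ennreal e" .
        qed
      qed
    qed
  qed
qed

section \<open>Nonnegative combinations of measures and point masses\<close>

definition comb :: "real \<Rightarrow> ('b set \<Rightarrow> real) \<Rightarrow> real \<Rightarrow> ('b set \<Rightarrow> real) \<Rightarrow> 'b set \<Rightarrow> real" where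
  "comb a \<mu> b \<nu> = (\<lambda>E. a * \<mu> E + b * \<nu> E)"

lemma comb_1_0 [simp]: "comb 1 \<mu> 0 \<nu> = \<mu>"
  by (simp add: comb_def)

lemma comb_apply: "comb a \<mu> b \<nu> E = a * \<mu> E + b * \<nu> E"
  by (simp add: comb_def)

lemma pos_measures_iff: "\<mu> \<in> pos_measures K \<longleftrightarrow> pos_signed_measure K \<mu> \<and> regular_measure K \<mu>"
  by (auto simp: pos_measures_def radon_measures_def pos_signed_measure_def)

lemma pos_signed_measure_comb:
  assumes \<mu>: "pos_signed_measure K \<mu>" and \<nu>: "pos_signed_measure K \<nu>" and "0 \<le> a" "0 \<le> b"
  shows "pos_signed_measure K (comb a \<mu> b \<nu>)"
  unfolding pos_signed_measure_def signed_measure_def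
proof (intro conjI allI impI ballI)
  show "comb a \<mu> b \<nu> {} = 0"
    using \<mu> \<nu> by (simp add: pos_signed_measure_def signed_measure_def comb_def)
  fix A :: "nat \<Rightarrow> _" assume "range A \<subseteq> borel_sets K \<and> disjoint_family A"
  then have "(\<lambda>n. \<mu> (A n)) sums \<mu> (\<Union>n. A n)" "(\<lambda>n. \<nu> (A n)) sums \<nu> (\<Union>n. A n)"
    using \<mu> \<nu> by (auto simp: pos_signed_measure_def signed_measure_def)
  then show "(\<lambda>n. comb a \<mu> b \<nu> (A n)) sums comb a \<mu> b \<nu> (\<Union>n. A n)"
    unfolding comb_def by (intro sums_add sums_mult)
qed (use assms in \<open>auto simp: pos_signed_measure_def signed_measure_def comb_def\<close>)

text \<open>Regularity survives because the union of two inner compact sets and the intersection of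
  two outer open sets approximate for both measures at once.\<close>

lemma pos_measures_comb:
  assumes K: "Hausdorff_space K" and \<mu>: "\<mu> \<in> pos_measures K" and \<nu>: "\<nu> \<in> pos_measures K"
    and ab: "0 \<le> a" "0 \<le> b"
  shows "comb a \<mu> b \<nu> \<in> pos_measures K"
proof -
  have ps: "pos_signed_measure K \<mu>" "pos_signed_measure K \<nu>" using \<mu> \<nu> by (auto simp: pos_measures_iff)
  note psc = pos_signed_measure_comb[OF ps ab]
  have "regular_measure K (comb a \<mu> b \<nu>)"
    unfolding regular_measure_pos_iff[OF psc K]
  proof (intro ballI allI impI)
    fix E and e :: real assume E: "E \<in> borel_sets K" and e: "e > 0"
    \<comment> \<open>The total error is at most \<open>(a + b) * d\<close>. The additional 1 makes
      the final inequality strict and keeps the denominator positive when both coefficients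
      vanish.\<close>
    define d where "d = e / (a + b + 1)"
    have d: "d > 0" using e ab by (simp add: d_def)
    obtain C U where CU: "compactin K C" "C \<subseteq> E" "openin K U" "E \<subseteq> U" "\<mu> U - \<mu> C < d"
      using \<mu> E d ps K by (metis pos_measures_iff regular_measure_pos_iff)
    obtain D V where DV: "compactin K D" "D \<subseteq> E" "openin K V" "E \<subseteq> V" "\<nu> V - \<nu> D < d"
      using \<nu> E d ps K by (metis pos_measures_iff regular_measure_pos_iff)
    let ?C = "C \<union> D" and ?U = "U \<inter> V"
    have *: "compactin K ?C" "openin K ?U" using CU DV by (auto intro: compactin_Un)
    note bor = borel_sets_compactin[OF K *(1)] borel_sets_compactin[OF K CU(1)] borel_sets_compactin[OF K DV(1)]
       borel_sets_openin[OF *(2)] borel_sets_openin[OF CU(3)] borel_sets_openin[OF DV(3)]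
    have "\<mu> ?U \<le> \<mu> U" "\<mu> C \<le> \<mu> ?C" "\<nu> ?U \<le> \<nu> V" "\<nu> D \<le> \<nu> ?C"
      using ps bor by (auto intro!: pos_signed_measure_mono[of K])
    then have "\<mu> ?U - \<mu> ?C \<le> d" "\<nu> ?U - \<nu> ?C \<le> d" using CU DV by linarith+
    then have "a * (\<mu> ?U - \<mu> ?C) + b * (\<nu> ?U - \<nu> ?C) \<le> a * d + b * d"
      using ab by (intro add_mono mult_left_mono) auto
    also have "\<dots> < (a + b + 1) * d" using d by (simp add: algebra_simps)
    also have "\<dots> = e" using ab by (simp add: d_def)
    finally have "comb a \<mu> b \<nu> ?U - comb a \<mu> b \<nu> ?C < e" by (simp add: comb_def algebra_simps)
    then show "\<exists>C U. compactin K C \<and> C \<subseteq> E \<and> openin K U \<and> E \<subseteq> U \<and> comb a \<mu> b \<nu> U - comb a \<mu> b \<nu> C < e"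
      using * CU DV by (intro exI[of _ ?C] exI[of _ ?U]) auto
  qed
  then show ?thesis using psc by (simp add: pos_measures_iff)
qed

lemma zero_pos_measures:
  assumes K: "Hausdorff_space K"
  shows "(\<lambda>_. 0) \<in> pos_measures K"
proof -
  have *: "pos_signed_measure K (\<lambda>_. 0)" by (auto simp: pos_signed_measure_def signed_measure_def)
  have "compactin K {} \<and> {} \<subseteq> E \<and> openin K (topspace K) \<and> E \<subseteq> topspace K \<and> (0::real) - 0 < e"
    if "E \<in> borel_sets K" "e > 0" for E e
    using that borel_sets_subset by simp
  then have "regular_measure K (\<lambda>_. 0)"
    unfolding regular_measure_pos_iff[OF * K] by blast
  with * show ?thesis by (simp add: pos_measures_iff)
qed

text \<open>The value 0 on non-Borel sets is the normalisation that \<open>signed_measure\<close>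
  prescribes.\<close>

definition dirac :: "'b topology \<Rightarrow> 'b \<Rightarrow> 'b set \<Rightarrow> real" where
  "dirac K x = (\<lambda>E. if E \<in> borel_sets K \<and> x \<in> E then 1 else 0)"

lemma pos_signed_measure_dirac: "pos_signed_measure K (dirac K x)"
  unfolding pos_signed_measure_def signed_measure_def
proof (intro conjI allI impI ballI)
  fix A :: "nat \<Rightarrow> _" assume A: "range A \<subseteq> borel_sets K \<and> disjoint_family A"
  then have U: "(\<Union>n. A n) \<in> borel_sets K"
    unfolding borel_sets_def by (blast intro: sigma_sets.Union)
  show "(\<lambda>n. dirac K x (A n)) sums dirac K x (\<Union>n. A n)"
  proof (cases "x \<in> (\<Union>n. A n)")
    case True
    then obtain i where i: "x \<in> A i" by blast
    then have "x \<in> A n \<longleftrightarrow> n = i" for n using A by (auto simp: disjoint_family_on_def)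
    then have "(\<lambda>n. dirac K x (A n)) = (\<lambda>n. if n = i then 1 else 0)"
      using A by (auto simp: dirac_def fun_eq_iff image_subset_iff)
    moreover have "dirac K x (\<Union>n. A n) = 1" using U True by (simp add: dirac_def)
    ultimately show ?thesis using sums_single[of i "\<lambda>_. 1::real"] by simp
  next
    case False
    then show ?thesis by (simp add: dirac_def)
  qed
qed (auto simp: dirac_def)

lemma dirac_pos_measures:
  assumes K: "Hausdorff_space K" and x: "x \<in> topspace K"
  shows "dirac K x \<in> pos_measures K"
proof -
  have "regular_measure K (dirac K x)"
    unfolding regular_measure_pos_iff[OF pos_signed_measure_dirac K]
  proof (intro ballI allI impI)
    fix E and e :: real assume E: "E \<in> borel_sets K" and e: "e > 0"
    show "\<exists>C U. compactin K C \<and> C \<subseteq> E \<and> openin K U \<and> E \<subseteq> U \<and> dirac K x U - dirac K x C < e"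
    proof (cases "x \<in> E")
      case True
      then show ?thesis
        using x e borel_sets_subset[OF E] borel_sets_compactin[OF K, of "{x}"]
        by (intro exI[of _ "{x}"] exI[of _ "topspace K"]) (auto simp: dirac_def)
    next
      case False
      have "closedin K {x}" using x K by (simp add: closedin_Hausdorff_singleton)
      with False show ?thesis
        using e borel_sets_subset[OF E]
        by (intro exI[of _ "{}"] exI[of _ "topspace K - {x}"]) (auto simp: dirac_def)
    qed
  qed
  then show ?thesis by (simp add: pos_measures_iff pos_signed_measure_dirac)
qed

section \<open>Integration of continuous functions\<close>

lemma continuous_borel_measurable:
  assumes "continuous_map K euclideanreal f"
  shows "f \<in> borel_measurable (borel_measure K \<mu>)"
proof (rule borel_measurableI)
  fix S :: "real set" assume "open S"
  then have "openin K {x \<in> topspace K. f x \<in> S}"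
    using assms by (simp add: openin_continuous_map_preimage)
  moreover have "{x \<in> topspace K. f x \<in> S} = f -` S \<inter> space (borel_measure K \<mu>)" by auto
  ultimately show "f -` S \<inter> space (borel_measure K \<mu>) \<in> sets (borel_measure K \<mu>)"
    by (simp add: borel_sets_openin)
qed

lemma continuous_bounded:
  assumes "compact_space K" "continuous_map K euclideanreal f"
  obtains B where "B > 0" "\<And>x. x \<in> topspace K \<Longrightarrow> \<bar>f x\<bar> \<le> B"
proof -
  have "compactin euclideanreal (f ` topspace K)"
    using assms by (intro image_compactin) (auto simp: compact_space_def)
  then have "bounded (f ` topspace K)" by (simp add: compact_imp_bounded)
  then show ?thesis using that unfolding bounded_pos by (metis image_eqI real_norm_def)
qed

lemma integrable_continuous:
  assumes "pos_signed_measure K \<mu>" "compact_space K" "continuous_map K euclideanreal f"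
  shows "integrable (borel_measure K \<mu>) f"
proof -
  obtain B where "\<And>x. x \<in> topspace K \<Longrightarrow> \<bar>f x\<bar> \<le> B"
    using continuous_bounded assms by metis
  then show ?thesis
    by (intro finite_measure.integrable_const_bound[of _ _ B] finite_measure_borel_measure
        continuous_borel_measurable assms AE_I2) auto
qed

text \<open>Here the integrand is fixed and the measure varies, so the identity is proved by
  induction on the integrand: indicators, multiples, sums and increasing suprema.\<close>

lemma nn_integral_comb:
  assumes ps: "pos_signed_measure K \<mu>" "pos_signed_measure K \<nu>" and ab: "0 \<le> a" "0 \<le> b"
    and f: "f \<in> borel_measurable (borel_measure K \<mu>)"
  shows "nn_integral (borel_measure K (comb a \<mu> b \<nu>)) f =
    ennreal a * nn_integral (borel_measure K \<mu>) f + ennreal b * nn_integral (borel_measure K \<nu>) f"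
    (is "?P f")
proof -
  note psc = pos_signed_measure_comb[OF ps ab]
  have cong: "borel_measurable (borel_measure K \<xi>) = borel_measurable (borel_measure K \<mu>)" for \<xi>
    by (rule measurable_cong_sets) auto
  show ?thesis using f
  proof (induction rule: borel_measurable_induct)
    case (cong f g)
    then show ?case
      by (metis nn_integral_cong space_borel_measure)
  next
    case (set A)
    then have A: "A \<in> borel_sets K" by simp
    have "0 \<le> \<mu> A" "0 \<le> \<nu> A" using ps A by (auto simp: pos_signed_measure_def)
    then show ?case
      using A ab by (simp add: emeasure_borel_measure ps psc)
        (simp add: comb_def ennreal_plus ennreal_mult)
  next
    case (mult u c)
    then have "u \<in> borel_measurable (borel_measure K \<xi>)" for \<xi> using cong by blast
    then show ?case using mult by (simp add: nn_integral_cmult algebra_simps)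
  next
    case (add u v)
    then have "u \<in> borel_measurable (borel_measure K \<xi>)" "v \<in> borel_measurable (borel_measure K \<xi>)" for \<xi>
      using cong by blast+
    then show ?case using add by (simp add: nn_integral_add algebra_simps)
  next
    case (seq U)
    then have m: "U i \<in> borel_measurable (borel_measure K \<xi>)" for i \<xi> using cong by blast
    have S: "(\<integral>\<^sup>+ x. (SUP i. U i) x \<partial>borel_measure K \<xi>) = (SUP i. \<integral>\<^sup>+ x. U i x \<partial>borel_measure K \<xi>)" for \<xi>
      unfolding SUP_apply by (rule nn_integral_monotone_convergence_SUP[OF \<open>incseq U\<close> m])
    have inc: "incseq (\<lambda>i. c * (\<integral>\<^sup>+ x. U i x \<partial>borel_measure K \<xi>))" for \<xi> and c :: ennreal
      using \<open>incseq U\<close>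
      by (auto simp: incseq_def le_fun_def intro!: mult_left_mono nn_integral_mono)
    show ?case
      unfolding S SUP_mult_left_ennreal seq.IH
      by (rule ennreal_SUP_add[OF inc inc])
  qed
qed

text \<open>Positive and negative parts of \<open>f\<close> are treated separately. Both integrals
  are finite because \<open>f\<close> is bounded on the compact space, and \<open>enn2real\<close>
  respects sums and multiples of finite values.\<close>

lemma signed_integral_comb:
  assumes K: "compact_space K" and ps: "pos_signed_measure K \<mu>" "pos_signed_measure K \<nu>"
    and ab: "0 \<le> a" "0 \<le> b" and f: "continuous_map K euclideanreal f"
  shows "signed_integral K (comb a \<mu> b \<nu>) f = a * signed_integral K \<mu> f + b * signed_integral K \<nu> f"
proof -
  note psc = pos_signed_measure_comb[OF ps ab]
  have m: "(\<lambda>x. ennreal (f x)) \<in> borel_measurable (borel_measure K \<mu>)"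
    "(\<lambda>x. ennreal (- f x)) \<in> borel_measurable (borel_measure K \<mu>)"
    using continuous_borel_measurable[OF f] by measurable
  have fin: "(\<integral>\<^sup>+ x. ennreal (f x) \<partial>borel_measure K \<xi>) < top" "(\<integral>\<^sup>+ x. ennreal (- f x) \<partial>borel_measure K \<xi>) < top"
    if "pos_signed_measure K \<xi>" for \<xi>
    using integrable_continuous[OF that K f] by (auto simp: real_integrable_def top.not_eq_extremum)
  have e: "enn2real (ennreal a * p + ennreal b * q) = a * enn2real p + b * enn2real q"
    if "p < top" "q < top" for p q
    using that ab by (simp add: enn2real_plus ennreal_mult_less_top enn2real_mult)
  have I: "integral\<^sup>L (borel_measure K \<xi>) f =
      enn2real (\<integral>\<^sup>+ x. ennreal (f x) \<partial>borel_measure K \<xi>) - enn2real (\<integral>\<^sup>+ x. ennreal (- f x) \<partial>borel_measure K \<xi>)"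
    if "pos_signed_measure K \<xi>" for \<xi>
    using integrable_continuous[OF that K f] by (rule real_lebesgue_integral_def)
  show ?thesis
    unfolding signed_integral_pos[OF psc] signed_integral_pos[OF ps(1)] signed_integral_pos[OF ps(2)]
      I[OF psc] I[OF ps(1)] I[OF ps(2)] nn_integral_comb[OF ps ab m(1)] nn_integral_comb[OF ps ab m(2)]
      e[OF fin(1)[OF ps(1)] fin(1)[OF ps(2)]] e[OF fin(2)[OF ps(1)] fin(2)[OF ps(2)]]
    by (simp add: algebra_simps)
qed

lemma signed_integral_one:
  assumes "pos_signed_measure K \<mu>"
  shows "signed_integral K \<mu> (\<lambda>_. 1) = \<mu> (topspace K)"
  using assms by (simp add: signed_integral_pos measure_borel_measure)

text \<open>The complement of the point is a null set, so \<open>f\<close> is almost everywhere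
  equal to the constant \<open>f x\<close>.\<close>

lemma signed_integral_dirac:
  assumes K: "Hausdorff_space K" and x: "x \<in> topspace K" and f: "continuous_map K euclideanreal f"
  shows "signed_integral K (dirac K x) f = f x"
proof -
  let ?M = "borel_measure K (dirac K x)"
  have "closedin K {x}" using x K by (simp add: closedin_Hausdorff_singleton)
  then have N: "topspace K - {x} \<in> borel_sets K"
    by (simp add: borel_sets_closedin borel_sets_Diff)
  have "emeasure ?M (topspace K - {x}) = 0"
    using N by (simp add: emeasure_borel_measure pos_signed_measure_dirac) (simp add: dirac_def)
  then have "AE y in ?M. f y = f x"
    using N by (intro AE_I[where N = "topspace K - {x}"]) auto
  then have "integral\<^sup>L ?M f = integral\<^sup>L ?M (\<lambda>_. f x)"
    by (intro integral_cong_AE continuous_borel_measurable f) auto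
  also have "\<dots> = f x"
    using x by (simp add: measure_borel_measure pos_signed_measure_dirac) (simp add: dirac_def)
  finally show ?thesis by (simp add: signed_integral_pos pos_signed_measure_dirac)
qed

section \<open>Dense embedded subsets\<close>

lemma C_embedded_imp_Cstar_embedded: "C_embedded Z A \<Longrightarrow> Cstar_embedded Z A"
  unfolding C_embedded_def Cstar_embedded_def by blast

lemma continuous_map_real_compose:
  fixes u :: "real \<Rightarrow> real"
  assumes "continuous_map X euclideanreal f" "continuous_on UNIV u"
  shows "continuous_map X euclideanreal (\<lambda>x. u (f x))"
  using continuous_map_compose[OF assms(1), of euclideanreal u] assms(2) by (simp add: o_def)

lemma dense_meets_open:
  assumes "A \<subseteq> topspace Z" "Z closure_of A = topspace Z" "openin Z W" "z \<in> W"
  shows "\<exists>a\<in>A. a \<in> W"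
proof -
  have "z \<in> Z closure_of A" using assms openin_subset by blast
  then show ?thesis using assms unfolding in_closure_of by blast
qed

lemma continuous_map_eq_on_dense:
  fixes f g :: "'b \<Rightarrow> real"
  assumes "continuous_map Z euclideanreal f" "continuous_map Z euclideanreal g"
    and dense: "A \<subseteq> topspace Z" "Z closure_of A = topspace Z"
    and eq: "\<And>a. a \<in> A \<Longrightarrow> f a = g a" and z: "z \<in> topspace Z"
  shows "f z = g z"
proof (rule ccontr)
  assume ne: "f z \<noteq> g z"
  have "continuous_map Z euclideanreal (\<lambda>x. f x - g x)"
    using assms by (intro continuous_map_diff) auto
  then have "openin Z {x \<in> topspace Z. f x - g x \<in> - {0}}"
    by (rule openin_continuous_map_preimage) auto
  then obtain a where "a \<in> A" "f a - g a \<in> - {0}"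
    using dense_meets_open[OF dense, of _ z] z ne by force
  then show False using eq by simp
qed

text \<open>A dense \<open>C\<close>-embedded set is \<open>G\<^sub>\<delta>\<close>-dense: otherwise \<open>1 / h\<close> would have no extension.\<close>

lemma C_embedded_meets_zero_set:
  assumes C: "C_embedded Z A" and dense: "Z closure_of A = topspace Z"
    and h: "continuous_map Z euclideanreal h" and z: "z \<in> topspace Z" "h z = 0"
  shows "\<exists>a\<in>A. h a = 0"
proof (rule ccontr)
  assume "\<not> ?thesis"
  then have ne: "\<And>a. a \<in> A \<Longrightarrow> h a \<noteq> 0" by blast
  have A: "A \<subseteq> topspace Z" using C by (simp add: C_embedded_def)
  have "continuous_map (subtopology Z A) euclideanreal (\<lambda>x. inverse (h x))"
    using ne A h by (intro continuous_map_real_inverse continuous_map_from_subtopology) auto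
  then obtain g where g: "continuous_map Z euclideanreal g" "\<And>x. x \<in> A \<Longrightarrow> g x = inverse (h x)"
    using C unfolding C_embedded_def by metis
  have "g z * h z = 1"
    by (rule continuous_map_eq_on_dense[where Z=Z and A=A])
      (use g h A dense ne z in \<open>auto intro!: continuous_map_real_mult\<close>)
  with z show False by simp
qed

text \<open>The bounded function arctan f extends to some \<open>g\<close>, and tan g extends
  \<open>f\<close> wherever cos g does not vanish. At a zero of cos g the function \<open>f\<close>
  is unbounded on the trace of every neighbourhood; on a connected trace its values then fill a long
  interval, so sin f takes both values 1 and -1 arbitrarily close to the point. This contradicts the
  continuity of the extension \<open>s\<close> of sin f.\<close>

lemma Cstar_embedded_imp_C_embedded:
  assumes Cs: "Cstar_embedded Z A" and dense: "Z closure_of A = topspace Z"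
    and conn: "\<And>W z. openin Z W \<Longrightarrow> z \<in> W \<Longrightarrow>
      \<exists>V. openin Z V \<and> z \<in> V \<and> V \<subseteq> W \<and> connectedin Z (V \<inter> A)"
  shows "C_embedded Z A"
  unfolding C_embedded_def
proof (intro conjI allI impI)
  show A: "A \<subseteq> topspace Z" using Cs by (simp add: Cstar_embedded_def)
  fix f :: "'a \<Rightarrow> real" assume f: "continuous_map (subtopology Z A) euclideanreal f"
  have "continuous_map (subtopology Z A) euclideanreal (\<lambda>x. arctan (f x))"
    by (intro continuous_map_real_compose[OF f] continuous_intros)
  moreover have "bounded ((\<lambda>x. arctan (f x)) ` A)"
    unfolding bounded_pos
  proof (intro exI[of _ "pi/2"] conjI ballI)
    fix y assume "y \<in> (\<lambda>x. arctan (f x)) ` A"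
    then obtain x where "y = arctan (f x)" by blast
    then show "norm y \<le> pi/2" using arctan_bounded[of "f x"] unfolding real_norm_def by linarith
  qed simp
  ultimately obtain g where g: "continuous_map Z euclideanreal g" "\<And>x. x \<in> A \<Longrightarrow> g x = arctan (f x)"
    using Cs unfolding Cstar_embedded_def by metis
  have "continuous_map (subtopology Z A) euclideanreal (\<lambda>x. sin (f x))"
    by (intro continuous_map_real_compose[OF f] continuous_intros)
  moreover have "bounded ((\<lambda>x. sin (f x)) ` A)"
    unfolding bounded_pos by (intro exI[of _ 1]) auto
  ultimately obtain s where s: "continuous_map Z euclideanreal s" "\<And>x. x \<in> A \<Longrightarrow> s x = sin (f x)"
    using Cs unfolding Cstar_embedded_def by metis
  have cos0: "cos (g z) \<noteq> 0" if z: "z \<in> topspace Z" for z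
  proof
    assume 0: "cos (g z) = 0"
    \<comment> \<open>Radius 1 is small enough: no real number has distance less than 1 from both 1
      and -1.\<close>
    let ?W = "{x \<in> topspace Z. s x \<in> ball (s z) 1}"
    have "openin Z ?W" using s(1) by (rule openin_continuous_map_preimage) auto
    then obtain V where V: "openin Z V" "z \<in> V" "V \<subseteq> ?W" "connectedin Z (V \<inter> A)"
      using conn[of ?W z] z by auto
    have "connectedin (subtopology Z A) (V \<inter> A)"
      using V(4) by (simp add: connectedin_subtopology)
    then have "connected (f ` (V \<inter> A))"
      using connectedin_continuous_map_image[OF f] by simp
    then have iv: "\<And>x y t. x \<in> V \<inter> A \<Longrightarrow> y \<in> V \<inter> A \<Longrightarrow> f x \<le> t \<Longrightarrow> t \<le> f y \<Longrightarrow> t \<in> f ` (V \<inter> A)"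
      unfolding connected_iff_interval by blast
    obtain a where a: "a \<in> V \<inter> A" using dense_meets_open[OF A dense V(1,2)] by blast
    text \<open>\<open>f\<close> is unbounded on \<open>V \<inter> A\<close>, because \<open>cos \<circ> arctan\<close> is bounded below on bounded sets.\<close>
    obtain b where b: "b \<in> V \<inter> A" "\<bar>f b\<bar> > \<bar>f a\<bar> + 14"
    proof -
      let ?c = "cos (arctan (\<bar>f a\<bar> + 14))"
      have "?c > 0" by (simp add: cos_arctan add_pos_nonneg)
      have "openin Z {x \<in> topspace Z. cos (g x) \<in> {..<?c}}"
        by (intro openin_continuous_map_preimage[of _ euclideanreal] continuous_map_real_compose[OF g(1)]
            continuous_intros) auto
      then have "openin Z (V \<inter> {x \<in> topspace Z. cos (g x) \<in> {..<?c}})" using V by blast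
      moreover have "z \<in> V \<inter> {x \<in> topspace Z. cos (g x) \<in> {..<?c}}" using V z 0 \<open>?c > 0\<close> by simp
      ultimately obtain b where b: "b \<in> A" "b \<in> V" "cos (g b) < ?c"
        using dense_meets_open[OF A dense] by blast
      have "\<bar>f b\<bar> > \<bar>f a\<bar> + 14"
      proof (rule ccontr)
        assume "\<not> ?thesis"
        then have "(f b)\<^sup>2 \<le> (\<bar>f a\<bar> + 14)\<^sup>2" by (simp add: abs_le_square_iff[symmetric])
        then have "sqrt (1 + (f b)\<^sup>2) \<le> sqrt (1 + (\<bar>f a\<bar> + 14)\<^sup>2)" by simp
        then have "?c \<le> cos (arctan (f b))"
          unfolding cos_arctan by (intro divide_left_mono mult_pos_pos) (auto intro: add_pos_nonneg)
        then show False using b g by simp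
      qed
      then show ?thesis using that b by blast
    qed
    define lo where "lo = min (f a) (f b)"
    have lohi: "lo + 14 \<le> max (f a) (f b)" using b unfolding lo_def by linarith
    have cover: "t \<in> f ` (V \<inter> A)" if "lo \<le> t" "t \<le> lo + 14" for t
      using iv[of a b t] iv[of b a t] a b that lohi unfolding lo_def by linarith
    \<comment> \<open>The first multiple of 2 pi not below \<open>lo\<close> is less than
      \<open>lo\<close> + 2 pi. Adding 3 pi / 2 to reach the point where the sine is -1 gives less
      than \<open>lo\<close> + 7 pi / 2, which is below \<open>lo\<close> + 14 as pi < 4. This
      explains the number 14.\<close>
    define k where "k = \<lceil>lo / (2*pi)\<rceil>"
    have "lo / (2*pi) \<le> k" "k < lo / (2*pi) + 1"
      unfolding k_def by linarith+
    then have k: "lo \<le> 2*pi*k" "2*pi*k < lo + 2*pi"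
      by (simp_all add: field_simps)
    have "sin (2*pi*k + pi/2) = 1"
      by (simp add: sin_add)
    moreover from this have "sin (2*pi*k + pi/2 + pi) = - 1"
      by (metis sin_periodic_pi)
    moreover have "2*pi*k + pi/2 \<in> f ` (V \<inter> A)" "2*pi*k + pi/2 + pi \<in> f ` (V \<inter> A)"
      using k pi_less_4 pi_gt_zero by (auto intro!: cover)
    ultimately obtain x y where "x \<in> V \<inter> A" "sin (f x) = 1" "y \<in> V \<inter> A" "sin (f y) = - 1"
      by (metis imageE)
    then have "dist (s z) 1 < 1" "dist (s z) (-1) < 1"
      using V(3) s(2) by force+
    then show False by (simp add: dist_real_def)
  qed
  have "continuous_map Z euclideanreal (\<lambda>x. tan (g x))"
    unfolding tan_def
    by (intro continuous_map_real_divide continuous_map_real_compose[OF g(1)] continuous_on_sin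
        continuous_on_cos continuous_on_id cos0)
  then show "\<exists>g. continuous_map Z euclideanreal g \<and> (\<forall>x\<in>A. g x = f x)"
    using g(2) by (intro exI[of _ "\<lambda>x. tan (g x)"]) (simp add: tan_arctan)
qed

text \<open>Countably many zero sets through \<open>z\<close> intersect in a single zero set, that
  of the uniformly convergent series of the truncated functions with weights
  \<open>(1/2)^n\<close>.\<close>

lemma C_embedded_meets_zero_sets:
  fixes h :: "nat \<Rightarrow> 'b \<Rightarrow> real"
  assumes C: "C_embedded Z A" and dense: "Z closure_of A = topspace Z"
    and h: "\<And>n. continuous_map Z euclideanreal (h n)" and z: "z \<in> topspace Z" "\<And>n. h n z = 0"
  shows "\<exists>a\<in>A. \<forall>n. h n a = 0"
proof -
  define u where "u n x = (1/2)^n * min 1 \<bar>h n x\<bar>" for n x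
  have le: "norm (u n x) \<le> (1/2)^n" and nn: "0 \<le> u n x" for n x
    by (auto simp: u_def abs_mult)
  have sm: "summable (\<lambda>n. u n x)" for x
    by (rule summable_comparison_test'[of "\<lambda>n. (1/2)^n"]) (use le in \<open>auto simp: summable_geometric\<close>)
  have ul: "uniform_limit UNIV (\<lambda>n x. \<Sum>i<n. u i x) (\<lambda>x. \<Sum>i. u i x) sequentially"
    by (rule Weierstrass_m_test[where M="\<lambda>n. (1/2)^n"]) (use le in \<open>auto simp: summable_geometric\<close>)
  have "continuous_map Z Met_TC.mtopology (\<lambda>x. \<Sum>i. u i x)"
  proof (rule Met_TC.continuous_map_uniform_limit)
    show "\<forall>\<^sub>F n in sequentially. continuous_map Z Met_TC.mtopology (\<lambda>x. \<Sum>i<n. u i x)"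
      unfolding u_def mtopology_is_euclidean
      by (intro always_eventually allI continuous_map_sum continuous_map_real_mult continuous_map_real_min
          continuous_map_real_abs h) auto
    show "\<forall>\<^sub>F n in sequentially. \<forall>x\<in>topspace Z. (\<Sum>i. u i x) \<in> UNIV \<and> dist (\<Sum>i<n. u i x) (\<Sum>i. u i x) < e"
      if "0 < e" for e
      using uniform_limitD[OF ul that] by eventually_elim auto
  qed auto
  then obtain a where a: "a \<in> A" "(\<Sum>i. u i a) = 0"
    using C_embedded_meets_zero_set[OF C dense, of "\<lambda>x. \<Sum>i. u i x" z] z
    unfolding mtopology_is_euclidean by (auto simp: u_def)
  then have "\<forall>n. u n a = 0" using suminf_eq_zero_iff[OF sm] nn by blast
  then have "h n a = 0" for n by (auto simp: u_def min_def split: if_splits dest: spec[of _ n])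
  with a show ?thesis by blast
qed

section \<open>Uniform limits over a compact set of parameters\<close>

lemma continuous_map_SUP_dist:
  fixes F :: "'b \<Rightarrow> real \<Rightarrow> real"
  assumes F: "continuous_map (prod_topology Y (top_of_set S)) euclideanreal (\<lambda>(x, t). F x t)"
    and S: "compact S" "S \<noteq> {}" and \<phi>: "continuous_on S \<phi>"
  shows "continuous_map Y euclideanreal (\<lambda>x. SUP t\<in>S. \<bar>F x t - \<phi> t\<bar>)"
    and "\<And>x t. x \<in> topspace Y \<Longrightarrow> t \<in> S \<Longrightarrow> \<bar>F x t - \<phi> t\<bar> \<le> (SUP t\<in>S. \<bar>F x t - \<phi> t\<bar>)"
proof -
  let ?P = "prod_topology Y (top_of_set S)"
  let ?G = "\<lambda>p. \<bar>F (fst p) (snd p) - \<phi> (snd p)\<bar>"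
  have G: "continuous_map ?P euclideanreal ?G"
  proof (intro continuous_map_real_abs continuous_map_diff)
    show "continuous_map ?P euclideanreal (\<lambda>p. F (fst p) (snd p))"
      using F by (simp add: case_prod_unfold)
    show "continuous_map ?P euclideanreal (\<lambda>p. \<phi> (snd p))"
      using continuous_map_compose[OF continuous_map_snd, of "top_of_set S" euclideanreal \<phi> Y] \<phi>
      by (simp add: o_def)
  qed
  have Fx: "continuous_on S (\<lambda>t. \<bar>F x t - \<phi> t\<bar>)" if "x \<in> topspace Y" for x
  proof -
    have "continuous_map (top_of_set S) ?P (\<lambda>t. (x, t))"
      using that by (intro continuous_map_pairedI) auto
    from continuous_map_compose[OF this G] show ?thesis by (simp add: o_def)
  qed
  \<comment> \<open>By compactness the supremum is a maximum, so inequalities for it can be read off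
    at a single parameter.\<close>
  have att: "\<exists>t\<in>S. \<bar>F x t - \<phi> t\<bar> = (SUP t\<in>S. \<bar>F x t - \<phi> t\<bar>) \<and> (\<forall>s\<in>S. \<bar>F x s - \<phi> s\<bar> \<le> \<bar>F x t - \<phi> t\<bar>)"
    if x: "x \<in> topspace Y" for x
  proof -
    obtain t where t: "t \<in> S" "\<forall>s\<in>S. \<bar>F x s - \<phi> s\<bar> \<le> \<bar>F x t - \<phi> t\<bar>"
      using continuous_attains_sup[OF S Fx[OF x]] by blast
    then have "(SUP t\<in>S. \<bar>F x t - \<phi> t\<bar>) = \<bar>F x t - \<phi> t\<bar>"
      by (intro cSup_eq_maximum) auto
    with t show ?thesis by metis
  qed
  show "\<And>x t. x \<in> topspace Y \<Longrightarrow> t \<in> S \<Longrightarrow> \<bar>F x t - \<phi> t\<bar> \<le> (SUP t\<in>S. \<bar>F x t - \<phi> t\<bar>)"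
    using att by metis
  have cs: "compact_space (top_of_set S)"
    using S by (simp add: compact_space_subtopology)
  show "continuous_map Y euclideanreal (\<lambda>x. SUP t\<in>S. \<bar>F x t - \<phi> t\<bar>)" (is "continuous_map Y _ ?s")
    unfolding continuous_map_upper_lower_semicontinuous_lt
  proof (intro conjI allI)
    fix c
    \<comment> \<open>Strict superlevel sets are projections of open sets of the product, and the
      projection is an open map.\<close>
    have "{x \<in> topspace Y. ?s x > c} = fst ` {p \<in> topspace ?P. ?G p \<in> {c<..}}"
    proof (intro set_eqI iffI)
      fix x assume "x \<in> {x \<in> topspace Y. ?s x > c}"
      then obtain t where "x \<in> topspace Y" "t \<in> S" "\<bar>F x t - \<phi> t\<bar> > c" using att by force
      then show "x \<in> fst ` {p \<in> topspace ?P. ?G p \<in> {c<..}}"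
        by (intro image_eqI[of _ _ "(x, t)"]) auto
    next
      fix x assume "x \<in> fst ` {p \<in> topspace ?P. ?G p \<in> {c<..}}"
      then obtain t where t: "x \<in> topspace Y" "t \<in> S" "\<bar>F x t - \<phi> t\<bar> > c" by auto
      obtain m where "\<bar>F x m - \<phi> m\<bar> = ?s x" "\<forall>s\<in>S. \<bar>F x s - \<phi> s\<bar> \<le> \<bar>F x m - \<phi> m\<bar>"
        using att[OF t(1)] by blast
      with t show "x \<in> {x \<in> topspace Y. ?s x > c}" by force
    qed
    moreover have "openin Y (fst ` {p \<in> topspace ?P. ?G p \<in> {c<..}})"
      using open_map_fst openin_continuous_map_preimage[OF G, of "{c<..}"] unfolding open_map_def by auto
    ultimately show "openin Y {x \<in> topspace Y. ?s x > c}" by simp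
    have "{x \<in> topspace Y. ?s x < c} = topspace Y - fst ` {p \<in> topspace ?P. ?G p \<in> {c..}}"
    proof (intro set_eqI iffI)
      fix x assume x: "x \<in> {x \<in> topspace Y. ?s x < c}"
      then obtain m where "\<bar>F x m - \<phi> m\<bar> = ?s x" "\<forall>s\<in>S. \<bar>F x s - \<phi> s\<bar> \<le> \<bar>F x m - \<phi> m\<bar>"
        using att[of x] by blast
      with x show "x \<in> topspace Y - fst ` {p \<in> topspace ?P. ?G p \<in> {c..}}" by force
    next
      fix x assume x: "x \<in> topspace Y - fst ` {p \<in> topspace ?P. ?G p \<in> {c..}}"
      then obtain m where m: "m \<in> S" "\<bar>F x m - \<phi> m\<bar> = ?s x" using att[of x] by blast
      have "\<not> c \<le> \<bar>F x m - \<phi> m\<bar>"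
      proof
        assume "c \<le> \<bar>F x m - \<phi> m\<bar>"
        then have "x \<in> fst ` {p \<in> topspace ?P. ?G p \<in> {c..}}"
          using m x by (intro image_eqI[of _ _ "(x, m)"]) auto
        then show False using x by blast
      qed
      then show "x \<in> {x \<in> topspace Y. ?s x < c}" using m x by simp
    qed
    moreover have "closedin Y (fst ` {p \<in> topspace ?P. ?G p \<in> {c..}})"
      using closed_map_fst[OF cs] closedin_continuous_map_preimage[OF G, of "{c..}"] unfolding closed_map_def by auto
    ultimately show "openin Y {x \<in> topspace Y. ?s x < c}" by (simp add: openin_diff)
  qed
qed

text \<open>The limit function is realised by a point of \<open>A\<close>: some \<open>a\<close>
  agrees with \<open>z\<close> for the extensions of F(., t), with t in a countable dense subset of
  \<open>S\<close>, and \<open>\<phi>\<close> is \<open>F a\<close>. The uniform distance from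
  \<open>F x\<close> to \<open>\<phi>\<close> is continuous on \<open>A\<close> and extends to
  \<open>D\<close> on \<open>Z\<close>. Once \<open>D z = 0\<close> is known, continuity of
  \<open>D\<close> gives uniform closeness near \<open>z\<close>.\<close>

lemma C_embedded_uniform_limit:
  fixes F :: "'b \<Rightarrow> real \<Rightarrow> real"
  assumes C: "C_embedded Z A" and dense: "Z closure_of A = topspace Z"
    and S: "compact S" "S \<noteq> {}"
    and F: "continuous_map (prod_topology (subtopology Z A) (top_of_set S)) euclideanreal (\<lambda>(x, t). F x t)"
    and z: "z \<in> topspace Z"
  obtains \<phi> where "continuous_on S \<phi>"
    "\<And>e. e > 0 \<Longrightarrow> \<exists>U. openin Z U \<and> z \<in> U \<and> (\<forall>a\<in>U \<inter> A. \<forall>t\<in>S. \<bar>F a t - \<phi> t\<bar> < e)"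
proof -
  let ?Y = "subtopology Z A"
  have A: "A \<subseteq> topspace Z" "topspace ?Y = A" using C by (auto simp: C_embedded_def)
  \<comment> \<open>Only countably many zero sets can be met simultaneously. A countable dense set
    of parameters suffices, since each \<open>F a\<close> is continuous on \<open>S\<close>.\<close>
  obtain T where T: "countable T" "T \<subseteq> S" "S \<subseteq> closure T" using separable by blast
  then have "T \<noteq> {}" using S by auto
  define \<tau> where "\<tau> = from_nat_into T"
  have \<tau>: "range \<tau> = T" unfolding \<tau>_def using T \<open>T \<noteq> {}\<close> by (simp add: range_from_nat_into)
  then have \<tau>S: "\<tau> n \<in> S" for n using T by blast
  have Ft: "continuous_map ?Y euclideanreal (\<lambda>x. F x t)" if "t \<in> S" for t
  proof -
    have "continuous_map ?Y (prod_topology ?Y (top_of_set S)) (\<lambda>x. (x, t))"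
      using that by (intro continuous_map_pairedI) auto
    from continuous_map_compose[OF this F] show ?thesis by (simp add: o_def)
  qed
  have Fa: "continuous_on S (F a)" if "a \<in> A" for a
  proof -
    have "continuous_map (top_of_set S) (prod_topology ?Y (top_of_set S)) (\<lambda>t. (a, t))"
      using that A by (intro continuous_map_pairedI) auto
    from continuous_map_compose[OF this F] show ?thesis by (simp add: o_def)
  qed
  have "\<forall>n. \<exists>g. continuous_map Z euclideanreal g \<and> (\<forall>x\<in>A. g x = F x (\<tau> n))"
    using C Ft[OF \<tau>S] unfolding C_embedded_def by blast
  then obtain g where g: "\<And>n. continuous_map Z euclideanreal (g n)" "\<And>n x. x \<in> A \<Longrightarrow> g n x = F x (\<tau> n)"
    by metis
  have "continuous_map Z euclideanreal (\<lambda>x. g n x - g n z)" for n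
    using g by (intro continuous_map_diff) auto
  then obtain a where a: "a \<in> A" "\<And>n. g n a = g n z"
    using C_embedded_meets_zero_sets[OF C dense, of "\<lambda>n x. g n x - g n z" z] z by auto
  define \<phi> where "\<phi> = F a"
  define d where "d x = (SUP t\<in>S. \<bar>F x t - \<phi> t\<bar>)" for x
  note d = continuous_map_SUP_dist[OF F S Fa[OF a(1)], folded \<phi>_def, folded d_def]
  obtain D where D: "continuous_map Z euclideanreal D" "\<And>x. x \<in> A \<Longrightarrow> D x = d x"
    using C d(1) unfolding C_embedded_def by metis
  \<comment> \<open>A second point \<open>b\<close> is needed because \<open>D\<close> depends on
    \<open>a\<close>. Index 0 forces \<open>D b = D z\<close>, the later indices force agreement
    with \<open>z\<close> for all \<open>g m\<close>. Then \<open>F b\<close> equals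
    \<open>\<phi>\<close> on \<open>T\<close>, hence on \<open>S\<close>, and so
    \<open>D z = D b = 0\<close>.\<close>
  define h where "h n x = (case n of 0 \<Rightarrow> D x - D z | Suc m \<Rightarrow> g m x - g m z)" for n x
  have "continuous_map Z euclideanreal (h n)" for n
    unfolding h_def using g D by (cases n) (auto intro!: continuous_map_diff)
  moreover have "h n z = 0" for n by (simp add: h_def split: nat.split)
  ultimately obtain b where b: "b \<in> A" "\<And>n. h n b = 0"
    using C_embedded_meets_zero_sets[OF C dense, of h z] z by auto
  have Db: "D b = D z" using b(2)[of 0] by (simp add: h_def)
  have "g n b = g n z" for n using b(2)[of "Suc n"] by (simp add: h_def)
  then have "F b (\<tau> n) = \<phi> (\<tau> n)" for n using a b g unfolding \<phi>_def by metis
  then have eq: "F b t = \<phi> t" if "t \<in> T" for t using that \<tau> by blast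
  have "F b t - \<phi> t = 0" if "t \<in> S" for t
  proof -
    have cont: "continuous_on S (\<lambda>t. F b t - \<phi> t)"
      unfolding \<phi>_def by (intro continuous_on_diff Fa a b)
    have "closed {t \<in> S. F b t - \<phi> t = 0}"
      using continuous_closed_preimage_constant[OF cont compact_imp_closed[OF S(1)], of 0] .
    then have "closure T \<subseteq> {t \<in> S. F b t - \<phi> t = 0}"
      using T eq by (intro closure_minimal) auto
    then show ?thesis using T that by blast
  qed
  then have "d b = 0" unfolding d_def using S by simp
  then have Dz: "D z = 0" using Db D b by simp
  show ?thesis
  proof (rule that)
    show "continuous_on S \<phi>" unfolding \<phi>_def by (rule Fa[OF a(1)])
    fix e :: real assume e: "e > 0"
    let ?U = "{x \<in> topspace Z. D x \<in> {..<e}}"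
    have "openin Z ?U" by (rule openin_continuous_map_preimage[OF D(1)]) auto
    moreover have "z \<in> ?U" using Dz e z by simp
    moreover have "\<bar>F x t - \<phi> t\<bar> < e" if "x \<in> ?U \<inter> A" "t \<in> S" for x t
      using d(2)[of x t] D(2)[of x] A that by simp
    ultimately show "\<exists>U. openin Z U \<and> z \<in> U \<and> (\<forall>a\<in>U \<inter> A. \<forall>t\<in>S. \<bar>F a t - \<phi> t\<bar> < e)" by blast
  qed
qed

section \<open>Cones of measures in the weak* topology\<close>

lemma topspace_weak_star: "topspace (weak_star K) = radon_measures K"
  unfolding weak_star_def topspace_pullback_topology by auto

lemma continuous_map_into_weak_star:
  assumes "g \<in> topspace T \<rightarrow> radon_measures K"
    and "\<And>f. continuous_map K euclideanreal f \<Longrightarrow> continuous_map T euclideanreal (\<lambda>x. signed_integral K (g x) f)"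
  shows "continuous_map T (weak_star K) g"
  unfolding weak_star_def
  by (rule continuous_map_pullback') (use assms in \<open>auto simp: continuous_map_componentwise o_def\<close>)

lemma continuous_map_signed_integral:
  assumes "continuous_map T (weak_star K) g" "continuous_map K euclideanreal f"
  shows "continuous_map T euclideanreal (\<lambda>x. signed_integral K (g x) f)"
proof -
  have "continuous_map (weak_star K) euclideanreal
      ((\<lambda>\<mu>. \<mu> f) \<circ> (\<lambda>\<mu>. \<lambda>f\<in>{f. continuous_map K euclideanreal f}. signed_integral K \<mu> f))"
    unfolding weak_star_def
    by (intro continuous_map_pullback continuous_map_product_projection) (use assms in simp)
  from continuous_map_compose[OF assms(1) this] show ?thesis using assms(2) by (simp add: o_def)
qed

lemma openin_finite_conditions:
  fixes h :: "'i \<Rightarrow> 'b \<Rightarrow> real"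
  assumes "finite F" "\<And>f. f \<in> F \<Longrightarrow> continuous_map Z euclideanreal (h f)"
  shows "openin Z {x \<in> topspace Z. \<forall>f\<in>F. \<bar>h f x - r f\<bar> < e}"
  using assms
proof (induction F)
  case (insert f F)
  have "openin Z {x \<in> topspace Z. h f x \<in> ball (r f) e}"
    using insert.prems by (intro openin_continuous_map_preimage) auto
  moreover have "openin Z {x \<in> topspace Z. \<forall>f\<in>F. \<bar>h f x - r f\<bar> < e}" using insert by auto
  ultimately have "openin Z ({x \<in> topspace Z. h f x \<in> ball (r f) e} \<inter> {x \<in> topspace Z. \<forall>f\<in>F. \<bar>h f x - r f\<bar> < e})"
    by blast
  also have "{x \<in> topspace Z. h f x \<in> ball (r f) e} \<inter> {x \<in> topspace Z. \<forall>f\<in>F. \<bar>h f x - r f\<bar> < e} =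
      {x \<in> topspace Z. \<forall>f\<in>insert f F. \<bar>h f x - r f\<bar> < e}"
    by (auto simp: dist_real_def abs_minus_commute)
  finally show ?case .
qed auto

definition weak_star_nbhd ::
  "'b topology \<Rightarrow> ('b \<Rightarrow> real) set \<Rightarrow> real \<Rightarrow> ('b set \<Rightarrow> real) \<Rightarrow> ('b set \<Rightarrow> real) set" where
  "weak_star_nbhd K F e \<mu> =
     {\<nu> \<in> radon_measures K. \<forall>f\<in>F. \<bar>signed_integral K \<nu> f - signed_integral K \<mu> f\<bar> < e}"

lemma openin_weak_star_nbhd:
  assumes "finite F" "\<And>f. f \<in> F \<Longrightarrow> continuous_map K euclideanreal f"
  shows "openin (weak_star K) (weak_star_nbhd K F e \<mu>)"
  unfolding weak_star_nbhd_def topspace_weak_star[symmetric]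
  using continuous_map_signed_integral[OF continuous_map_id[unfolded id_def]]
  by (intro openin_finite_conditions assms) (use assms in auto)

text \<open>A basic open set of the product restricts only finitely many coordinates, and each
  restriction contains a ball around the integral of \<open>\<mu>\<close>.\<close>

lemma weak_star_nbhd_basis:
  assumes W: "openin (weak_star K) W" and \<mu>: "\<mu> \<in> W"
  obtains F e where "finite F" "\<And>f. f \<in> F \<Longrightarrow> continuous_map K euclideanreal f" "e > 0"
    "weak_star_nbhd K F e \<mu> \<subseteq> W"
proof -
  let ?C = "{f. continuous_map K euclideanreal f}"
  let ?\<Phi> = "\<lambda>\<mu>. \<lambda>f\<in>?C. signed_integral K \<mu> f"
  obtain U where U: "openin (product_topology (\<lambda>f. euclideanreal) ?C) U" "W = ?\<Phi> -` U \<inter> radon_measures K"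
    using W unfolding weak_star_def openin_pullback_topology by blast
  then obtain V where V: "?\<Phi> \<mu> \<in> PiE ?C V" "\<And>f. open (V f)" "finite {f. V f \<noteq> UNIV}" "PiE ?C V \<subseteq> U"
    using product_topology_open_contains_basis[OF U(1), of "?\<Phi> \<mu>"] \<mu> by auto
  define F where "F = {f. V f \<noteq> UNIV} \<inter> ?C"
  have "finite F" using V by (simp add: F_def)
  have "\<exists>e>0. ball (signed_integral K \<mu> f) e \<subseteq> V f" if "f \<in> F" for f
  proof -
    have "signed_integral K \<mu> f \<in> V f" using V(1) that by (auto simp: F_def PiE_iff)
    then show ?thesis using V(2) open_contains_ball by blast
  qed
  then obtain r where r: "\<And>f. f \<in> F \<Longrightarrow> r f > 0" "\<And>f. f \<in> F \<Longrightarrow> ball (signed_integral K \<mu> f) (r f) \<subseteq> V f"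
    by metis
  \<comment> \<open>Inserting 1 keeps the minimum meaningful when \<open>F\<close> is empty.\<close>
  define e where "e = Min (insert 1 (r ` F))"
  have e: "e > 0" "\<And>f. f \<in> F \<Longrightarrow> e \<le> r f"
    unfolding e_def using \<open>finite F\<close> r(1) by auto
  show ?thesis
  proof (rule that[OF \<open>finite F\<close> _ e(1)])
    show "weak_star_nbhd K F e \<mu> \<subseteq> W"
    proof
      fix \<nu> assume \<nu>: "\<nu> \<in> weak_star_nbhd K F e \<mu>"
      have "signed_integral K \<nu> f \<in> V f" if "f \<in> ?C" for f
      proof (cases "f \<in> F")
        case True
        then have "\<bar>signed_integral K \<nu> f - signed_integral K \<mu> f\<bar> < r f"
          using \<nu> e(2)[OF True] unfolding weak_star_nbhd_def by force
        then have "signed_integral K \<nu> f \<in> ball (signed_integral K \<mu> f) (r f)"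
          by (simp add: dist_real_def abs_minus_commute)
        then show ?thesis using r(2)[OF True] by blast
      next
        case False
        then show ?thesis using that by (simp add: F_def)
      qed
      then have "?\<Phi> \<nu> \<in> PiE ?C V" by auto
      then show "\<nu> \<in> W" using \<nu> V U unfolding weak_star_nbhd_def by blast
    qed
  qed (simp add: F_def)
qed

text \<open>The coefficients may vary along with the measures, which covers segments, scaling and
  normalisation of mass. Each integral of the combination is a sum of products of continuous
  functions.\<close>

lemma continuous_map_comb:
  assumes K: "compact_space K" "Hausdorff_space K"
    and g: "continuous_map T (weak_star K) g" "g \<in> topspace T \<rightarrow> pos_measures K"
    and h: "continuous_map T (weak_star K) h" "h \<in> topspace T \<rightarrow> pos_measures K"
    and a: "continuous_map T euclideanreal a" "\<And>x. x \<in> topspace T \<Longrightarrow> 0 \<le> a x"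
    and b: "continuous_map T euclideanreal b" "\<And>x. x \<in> topspace T \<Longrightarrow> 0 \<le> b x"
  shows "continuous_map T (weak_star K) (\<lambda>x. comb (a x) (g x) (b x) (h x))"
proof (rule continuous_map_into_weak_star)
  have "comb (a x) (g x) (b x) (h x) \<in> pos_measures K" if "x \<in> topspace T" for x
    using that g(2) h(2) a(2) b(2) by (intro pos_measures_comb K) auto
  then show "(\<lambda>x. comb (a x) (g x) (b x) (h x)) \<in> topspace T \<rightarrow> radon_measures K"
    by (auto simp: pos_measures_def)
  fix f assume f: "continuous_map K euclideanreal f"
  have "continuous_map T euclideanreal (\<lambda>x. a x * signed_integral K (g x) f + b x * signed_integral K (h x) f)"
    by (intro continuous_map_add continuous_map_real_mult continuous_map_signed_integral f a b g h)
  then show "continuous_map T euclideanreal (\<lambda>x. signed_integral K (comb (a x) (g x) (b x) (h x)) f)"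
  proof (rule continuous_map_eq)
    fix x assume "x \<in> topspace T"
    then have "pos_signed_measure K (g x)" "pos_signed_measure K (h x)" "0 \<le> a x" "0 \<le> b x"
      using g(2) h(2) a(2) b(2) by (auto simp: pos_measures_iff Pi_iff)
    from signed_integral_comb[OF K(1) this f]
    show "a x * signed_integral K (g x) f + b x * signed_integral K (h x) f =
      signed_integral K (comb (a x) (g x) (b x) (h x)) f" by simp
  qed
qed

lemma continuous_map_mass:
  assumes "B \<subseteq> pos_measures K"
  shows "continuous_map (subtopology (weak_star K) B) euclideanreal (\<lambda>\<mu>. \<mu> (topspace K))"
proof (rule continuous_map_eq)
  show "continuous_map (subtopology (weak_star K) B) euclideanreal (\<lambda>\<mu>. signed_integral K \<mu> (\<lambda>_. 1))"
    by (intro continuous_map_from_subtopology continuous_map_signed_integral continuous_map_id[unfolded id_def]) auto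
  fix \<mu> assume "\<mu> \<in> topspace (subtopology (weak_star K) B)"
  then show "signed_integral K \<mu> (\<lambda>_. 1) = \<mu> (topspace K)"
    using assms by (intro signed_integral_one) (auto simp: pos_measures_iff)
qed

section \<open>Convex cones of measures and approximation by point masses\<close>

text \<open>The classes \<open>M\<^sub>p\<^sup>+(X)\<close> enter the argument only as convex cones that contain the point masses
  at a dense set \<open>D\<close> of points of the compactification.\<close>

definition measure_cone :: "'b topology \<Rightarrow> 'b set \<Rightarrow> ('b set \<Rightarrow> real) set \<Rightarrow> bool" where
  "measure_cone K D A \<longleftrightarrow> A \<subseteq> pos_measures K \<and> (\<lambda>_. 0) \<in> A \<and>
     (\<forall>\<mu>\<in>A. \<forall>\<nu>\<in>A. \<forall>a\<ge>0. \<forall>b\<ge>0. comb a \<mu> b \<nu> \<in> A) \<and> (\<forall>x\<in>D. dirac K x \<in> A)"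

lemma measure_coneD:
  assumes "measure_cone K D A"
  shows "A \<subseteq> pos_measures K" "(\<lambda>_. 0) \<in> A"
    "\<And>\<mu> \<nu> a b. \<mu> \<in> A \<Longrightarrow> \<nu> \<in> A \<Longrightarrow> 0 \<le> a \<Longrightarrow> 0 \<le> b \<Longrightarrow> comb a \<mu> b \<nu> \<in> A"
    "\<And>x. x \<in> D \<Longrightarrow> dirac K x \<in> A"
  using assms by (auto simp: measure_cone_def)

lemma measure_cone_topspace:
  assumes "measure_cone K D A"
  shows "topspace (subtopology (weak_star K) A) = A"
    "topspace (subtopology (weak_star K) (A \<inter> prob_measures K)) = A \<inter> prob_measures K"
  using measure_coneD(1)[OF assms] by (auto simp: topspace_weak_star pos_measures_def)

lemma measure_cone_prob_iff:
  "measure_cone K D A \<Longrightarrow> \<mu> \<in> A \<inter> prob_measures K \<longleftrightarrow> \<mu> \<in> A \<and> \<mu> (topspace K) = 1"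
  using measure_coneD(1) by (auto simp: prob_measures_def)

lemma measure_cone_dirac_combination:
  assumes A: "measure_cone K D A" and K: "compact_space K" "Hausdorff_space K" and D: "D \<subseteq> topspace K"
    and J: "finite J" "\<And>j. j \<in> J \<Longrightarrow> w j \<ge> 0" "\<And>j. j \<in> J \<Longrightarrow> p j \<in> D"
  shows "\<exists>\<nu>\<in>A. \<nu> (topspace K) = sum w J \<and>
    (\<forall>f. continuous_map K euclideanreal f \<longrightarrow> signed_integral K \<nu> f = (\<Sum>j\<in>J. w j * f (p j)))"
  using J
proof (induction J)
  case empty
  have z: "(\<lambda>_. 0) \<in> A" "pos_signed_measure K (\<lambda>_. 0)"
    using measure_coneD[OF A] by (auto simp: pos_measures_iff)
  \<comment> \<open>The integral against the zero measure is read off from linearity with both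
    coefficients equal to 0.\<close>
  have "signed_integral K (comb 0 (\<lambda>_. 0) 0 (\<lambda>_. 0)) f = 0" if "continuous_map K euclideanreal f" for f
    using signed_integral_comb[OF K(1) z(2) z(2) _ _ that, of 0 0] by simp
  then show ?case using z by (intro bexI[of _ "\<lambda>_. 0"]) (auto simp: comb_def)
next
  case (insert i J)
  then obtain \<nu> where \<nu>: "\<nu> \<in> A" "\<nu> (topspace K) = sum w J"
    "\<And>f. continuous_map K euclideanreal f \<Longrightarrow> signed_integral K \<nu> f = (\<Sum>j\<in>J. w j * f (p j))"
    by auto
  have i: "w i \<ge> 0" "p i \<in> D" "p i \<in> topspace K" using insert D by auto
  have ps: "pos_signed_measure K \<nu>" using measure_coneD(1)[OF A] \<nu> by (auto simp: pos_measures_iff)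
  let ?\<nu> = "comb 1 \<nu> (w i) (dirac K (p i))"
  have "?\<nu> \<in> A" using measure_coneD[OF A] \<nu> i by auto
  moreover have "?\<nu> (topspace K) = sum w (insert i J)"
    using insert \<nu> i by (simp add: comb_def dirac_def)
  moreover have "signed_integral K ?\<nu> f = (\<Sum>j\<in>insert i J. w j * f (p j))"
    if "continuous_map K euclideanreal f" for f
    using insert \<nu>(3)[OF that] i signed_integral_comb[OF K(1) ps pos_signed_measure_dirac _ i(1) that, of 1]
    by (simp add: signed_integral_dirac K that)
  ultimately show ?case by blast
qed

text \<open>Partition \<open>K\<close> into finitely many Borel pieces on which every \<open>f \<in> F\<close> oscillates by less than \<open>c\<close>
  and move the mass of each piece to a nearby point of \<open>D\<close>.\<close>

lemma measure_cone_approx: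
  assumes A: "measure_cone K D A" and K: "compact_space K" "Hausdorff_space K"
    and D: "D \<subseteq> topspace K" "K closure_of D = topspace K"
    and \<mu>: "\<mu> \<in> pos_measures K" and F: "finite F" "\<And>f. f \<in> F \<Longrightarrow> continuous_map K euclideanreal f"
    and e: "e > 0"
  shows "\<exists>\<nu>\<in>A. \<nu> (topspace K) = \<mu> (topspace K) \<and> \<nu> \<in> weak_star_nbhd K F e \<mu>"
proof -
  have ps: "pos_signed_measure K \<mu>" using \<mu> by (simp add: pos_measures_iff)
  let ?M = "borel_measure K \<mu>"
  interpret finite_measure ?M by (rule finite_measure_borel_measure[OF ps])
  have m0: "0 \<le> \<mu> (topspace K)" using ps by (simp add: pos_signed_measure_def)
  \<comment> \<open>Moving the mass changes each test function by at most \<open>2 * c\<close>,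
    hence its integral by at most \<open>2 * c\<close> times the mass. The summand 1 covers the case
    of zero mass.\<close>
  define c where "c = e / (2 * (\<mu> (topspace K) + 1))"
  have c: "c > 0" using e m0 by (simp add: c_def)
  have ce: "2 * c * \<mu> (topspace K) < e"
  proof -
    have "2 * c * \<mu> (topspace K) < 2 * c * (\<mu> (topspace K) + 1)" using c by simp
    also have "\<dots> = e" using m0 by (simp add: c_def field_simps)
    finally show ?thesis .
  qed
  \<comment> \<open>\<open>J x\<close> records the levels of the test functions at \<open>x\<close>,
    and \<open>E j\<close> is the cell with levels \<open>j\<close>; within a cell each test
    function varies by less than \<open>c\<close>. Restriction to \<open>F\<close> puts all level
    vectors into a finite product of integer intervals.\<close>
  define J where "J x = (\<lambda>f\<in>F. \<lfloor>f x / c\<rfloor>)" for x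
  define E where "E j = {x \<in> topspace K. \<forall>f\<in>F. \<lfloor>f x / c\<rfloor> = j f}" for j
  let ?J = "J ` topspace K"
  have "finite ?J"
  proof -
    have "\<exists>B. \<forall>x\<in>topspace K. \<bar>f x\<bar> \<le> B" if "f \<in> F" for f
      using continuous_bounded[OF K(1) F(2)[OF that]] by metis
    then obtain B where B: "\<And>f x. f \<in> F \<Longrightarrow> x \<in> topspace K \<Longrightarrow> \<bar>f x\<bar> \<le> B f" by metis
    have "?J \<subseteq> PiE F (\<lambda>f. {\<lfloor>- B f / c\<rfloor>..\<lfloor>B f / c\<rfloor>})"
    proof
      fix j assume "j \<in> ?J"
      then obtain x where x: "x \<in> topspace K" "j = J x" by blast
      have "\<lfloor>f x / c\<rfloor> \<in> {\<lfloor>- B f / c\<rfloor>..\<lfloor>B f / c\<rfloor>}" if "f \<in> F" for f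
      proof -
        have "- B f \<le> f x" "f x \<le> B f" using B[OF that x(1)] by linarith+
        then show ?thesis using c unfolding atLeastAtMost_iff
          by (intro conjI floor_mono divide_right_mono) auto
      qed
      then show "j \<in> PiE F (\<lambda>f. {\<lfloor>- B f / c\<rfloor>..\<lfloor>B f / c\<rfloor>})" by (auto simp: x J_def)
    qed
    then show ?thesis using F(1) by (rule finite_subset[OF _ finite_PiE]) auto
  qed
  have EJ: "x \<in> E j \<longleftrightarrow> J x = j" if xj: "x \<in> topspace K" "j \<in> ?J" for x j
  proof
    assume x: "x \<in> E j"
    obtain x' where j: "j = J x'" using xj by blast
    have "\<lfloor>f x / c\<rfloor> = \<lfloor>f x' / c\<rfloor>" if "f \<in> F" for f
      using x that by (simp add: E_def j J_def)
    then show "J x = j" unfolding j J_def by (rule restrict_ext)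
  next
    assume "J x = j"
    then show "x \<in> E j" using xj(1) by (simp add: E_def J_def flip: \<open>J x = j\<close>)
  qed
  have EI: "E j \<inter> topspace K = E j" for j by (auto simp: E_def)
  have EB: "E j \<in> borel_sets K" for j
  proof -
    have "{x \<in> space ?M. \<lfloor>f x / c\<rfloor> = j f} \<in> sets ?M" if "f \<in> F" for f
    proof -
      have [measurable]: "f \<in> borel_measurable ?M"
        by (rule continuous_borel_measurable[OF F(2)[OF that]])
      show ?thesis unfolding floor_eq_iff by measurable
    qed
    then have "{x \<in> space ?M. \<forall>f\<in>F. \<lfloor>f x / c\<rfloor> = j f} \<in> sets ?M"
      by (rule sets.sets_Collect_finite_All[OF _ F(1)])
    then show ?thesis by (simp add: E_def)
  qed
  \<comment> \<open>A cell need not meet \<open>D\<close>. So a point \<open>y\<close> of the cell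
    is chosen first, and then a point \<open>p\<close> of \<open>D\<close> at which all test
    functions are within \<open>c\<close> of their values at \<open>y\<close>.\<close>
  have "\<exists>y\<in>topspace K. \<exists>p\<in>D. J y = j \<and> (\<forall>f\<in>F. \<bar>f p - f y\<bar> < c)" if j: "j \<in> ?J" for j
  proof -
    obtain y where y: "y \<in> topspace K" "J y = j" using j by auto
    have "openin K {x \<in> topspace K. \<forall>f\<in>F. \<bar>f x - f y\<bar> < c}"
      by (rule openin_finite_conditions[of F K "\<lambda>f. f" "\<lambda>f. f y"]) (use F in auto)
    then show ?thesis using dense_meets_open[OF D, of _ y] y c by force
  qed
  then obtain y p where yp: "\<And>j. j \<in> ?J \<Longrightarrow> y j \<in> topspace K" "\<And>j. j \<in> ?J \<Longrightarrow> p j \<in> D"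
    "\<And>j. j \<in> ?J \<Longrightarrow> J (y j) = j" "\<And>j f. j \<in> ?J \<Longrightarrow> f \<in> F \<Longrightarrow> \<bar>f (p j) - f (y j)\<bar> < c"
    by metis
  \<comment> \<open>Each point lies in exactly one cell, so a function of the level vector is a
    finite sum of multiples of indicators.\<close>
  have step: "(\<lambda>x. \<Sum>j\<in>?J. u j * indicator (E j) x) x = u (J x)" if "x \<in> topspace K" for u :: "_ \<Rightarrow> real" and x
  proof -
    have "(\<Sum>j\<in>?J. u j * indicator (E j) x) = (\<Sum>j\<in>?J. if j = J x then u j else 0)"
      using EJ[OF that] by (intro sum.cong) (auto simp: indicator_def)
    then show ?thesis using \<open>finite ?J\<close> that by simp
  qed
  have indi: "integrable ?M (\<lambda>x. u * indicator (E j) x)" for u :: real and j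
    using EB by (simp add: emeasure_finite less_top[symmetric])
  have int_step: "integrable ?M (\<lambda>x. u (J x))" "integral\<^sup>L ?M (\<lambda>x. u (J x)) = (\<Sum>j\<in>?J. \<mu> (E j) * u j)"
    for u :: "_ \<Rightarrow> real"
  proof -
    have cong: "integrable ?M (\<lambda>x. u (J x)) \<longleftrightarrow> integrable ?M (\<lambda>x. \<Sum>j\<in>?J. u j * indicator (E j) x)"
      "integral\<^sup>L ?M (\<lambda>x. u (J x)) = integral\<^sup>L ?M (\<lambda>x. \<Sum>j\<in>?J. u j * indicator (E j) x)"
      using step[of _ u] by (auto intro!: Bochner_Integration.integral_cong Bochner_Integration.integrable_cong)
    show "integrable ?M (\<lambda>x. u (J x))" unfolding cong by (intro Bochner_Integration.integrable_sum indi)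
    have "integral\<^sup>L ?M (\<lambda>x. \<Sum>j\<in>?J. u j * indicator (E j) x) = (\<Sum>j\<in>?J. integral\<^sup>L ?M (\<lambda>x. u j * indicator (E j) x))"
      by (intro Bochner_Integration.integral_sum indi)
    also have "\<dots> = (\<Sum>j\<in>?J. \<mu> (E j) * u j)"
      using EB EI by (intro sum.cong) (auto simp: measure_borel_measure[OF ps])
    finally show "integral\<^sup>L ?M (\<lambda>x. u (J x)) = (\<Sum>j\<in>?J. \<mu> (E j) * u j)" unfolding cong .
  qed
  have w: "\<mu> (E j) \<ge> 0" for j using ps EB by (simp add: pos_signed_measure_def)
  have "\<exists>\<nu>\<in>A. \<nu> (topspace K) = (\<Sum>j\<in>?J. \<mu> (E j)) \<and>
      (\<forall>f. continuous_map K euclideanreal f \<longrightarrow> signed_integral K \<nu> f = (\<Sum>j\<in>?J. \<mu> (E j) * f (p j)))"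
    by (rule measure_cone_dirac_combination[OF A K D(1) \<open>finite ?J\<close> w yp(2)])
  then obtain \<nu> where \<nu>: "\<nu> \<in> A" "\<nu> (topspace K) = (\<Sum>j\<in>?J. \<mu> (E j))"
    "\<And>f. continuous_map K euclideanreal f \<Longrightarrow> signed_integral K \<nu> f = (\<Sum>j\<in>?J. \<mu> (E j) * f (p j))"
    by blast
  have mass: "\<nu> (topspace K) = \<mu> (topspace K)"
    using \<nu>(2) int_step(2)[of "\<lambda>_. 1"] by (simp add: measure_borel_measure[OF ps])
  have "\<bar>signed_integral K \<nu> f - signed_integral K \<mu> f\<bar> < e" if f: "f \<in> F" for f
  proof -
    note fc = F(2)[OF f] and fi = integrable_continuous[OF ps K(1) F(2)[OF f]]
    have close: "\<bar>f (p (J x)) - f x\<bar> \<le> 2 * c" if "x \<in> topspace K" for x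
    proof -
      have "J (y (J x)) = J x" using yp(3) that by blast
      then have "\<lfloor>f (y (J x)) / c\<rfloor> = \<lfloor>f x / c\<rfloor>" using f by (metis J_def restrict_apply')
      then have "\<bar>f (y (J x)) / c - f x / c\<bar> < 1" by linarith
      then have "\<bar>f (y (J x)) - f x\<bar> < c"
        using c by (simp add: abs_less_iff field_simps)
      moreover have "\<bar>f (p (J x)) - f (y (J x))\<bar> < c" using yp(4) that f by blast
      ultimately show ?thesis by linarith
    qed
    have "signed_integral K \<nu> f - signed_integral K \<mu> f = integral\<^sup>L ?M (\<lambda>x. f (p (J x)) - f x)"
      unfolding \<nu>(3)[OF fc] signed_integral_pos[OF ps] int_step(2)[of "\<lambda>j. f (p j)", symmetric]
      by (rule Bochner_Integration.integral_diff[symmetric, OF int_step(1) fi])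
    also have "\<bar>\<dots>\<bar> \<le> integral\<^sup>L ?M (\<lambda>x. \<bar>f (p (J x)) - f x\<bar>)"
      by (rule integral_abs_bound)
    also have "\<dots> \<le> integral\<^sup>L ?M (\<lambda>x. 2 * c)"
      using close int_step(1)[of "\<lambda>j. f (p j)"] fi by (intro integral_mono) auto
    also have "\<dots> = 2 * c * \<mu> (topspace K)" by (simp add: measure_borel_measure[OF ps])
    finally show ?thesis using ce by linarith
  qed
  moreover have "\<nu> \<in> radon_measures K" using measure_coneD(1)[OF A] \<nu>(1) by (auto simp: pos_measures_def)
  ultimately show ?thesis using \<nu>(1) mass by (auto simp: weak_star_nbhd_def)
qed

text \<open>The approximating combinations of point masses keep the total mass, so the same
  approximation gives density for the cones and for the probability measures.\<close>

lemma closure_of_measure_cone: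
  assumes A: "measure_cone K D A" and B: "measure_cone K D B"
    and K: "compact_space K" "Hausdorff_space K"
    and D: "D \<subseteq> topspace K" "K closure_of D = topspace K"
  shows "B \<subseteq> weak_star K closure_of A"
    and "B \<inter> prob_measures K \<subseteq> weak_star K closure_of (A \<inter> prob_measures K)"
proof -
  have approx: "\<exists>\<nu>\<in>A. \<nu> (topspace K) = \<mu> (topspace K) \<and> \<nu> \<in> W"
    if "\<mu> \<in> B" "openin (weak_star K) W" "\<mu> \<in> W" for \<mu> W
  proof -
    obtain F e where F: "finite F" "\<And>f. f \<in> F \<Longrightarrow> continuous_map K euclideanreal f" "e > 0"
      "weak_star_nbhd K F e \<mu> \<subseteq> W"
      using weak_star_nbhd_basis \<open>openin (weak_star K) W\<close> \<open>\<mu> \<in> W\<close> by metis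
    have "\<mu> \<in> pos_measures K" using B \<open>\<mu> \<in> B\<close> measure_coneD(1) by blast
    from measure_cone_approx[OF A K D this F(1-3)] F(4) show ?thesis by blast
  qed
  have Bt: "B \<subseteq> topspace (weak_star K)"
    using measure_coneD(1)[OF B] by (auto simp: topspace_weak_star pos_measures_def)
  show "B \<subseteq> weak_star K closure_of A"
    using Bt approx unfolding closure_of_def by blast
  show "B \<inter> prob_measures K \<subseteq> weak_star K closure_of (A \<inter> prob_measures K)"
  proof
    fix \<mu> assume \<mu>: "\<mu> \<in> B \<inter> prob_measures K"
    then have "\<mu> (topspace K) = 1" by (simp add: prob_measures_def)
    moreover have "\<mu> \<in> topspace (weak_star K)" using \<mu> Bt by blast
    ultimately show "\<mu> \<in> weak_star K closure_of (A \<inter> prob_measures K)"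
      unfolding in_closure_of
    proof (intro conjI allI impI)
      fix W assume "\<mu> \<in> W \<and> openin (weak_star K) W"
      then obtain \<nu> where "\<nu> \<in> A" "\<nu> (topspace K) = \<mu> (topspace K)" "\<nu> \<in> W"
        using approx[of \<mu> W] \<mu> by blast
      with \<open>\<mu> (topspace K) = 1\<close> show "\<exists>\<nu>. \<nu> \<in> A \<inter> prob_measures K \<and> \<nu> \<in> W"
        using measure_cone_prob_iff[OF A, of \<nu>] by auto
    qed
  qed
qed

section \<open>Convexity, connectedness and the passage from C*- to C-embeddings\<close>

lemma convex_combination_prob:
  assumes A: "measure_cone K D A" and "\<mu> \<in> A \<inter> prob_measures K" "\<nu> \<in> A \<inter> prob_measures K" "0 \<le> t" "t \<le> 1"
  shows "comb (1 - t) \<mu> t \<nu> \<in> A \<inter> prob_measures K"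
  using assms(2-) unfolding measure_cone_prob_iff[OF A]
  by (auto intro!: measure_coneD(3)[OF A] simp: comb_apply)

text \<open>Basic weak* neighbourhoods are convex, so their traces on \<open>P\<^sub>p(X)\<close> are connected.\<close>

lemma connectedin_weak_star_nbhd_prob:
  assumes A: "measure_cone K D A" and K: "compact_space K" "Hausdorff_space K"
    and F: "\<And>f. f \<in> F \<Longrightarrow> continuous_map K euclideanreal f"
  shows "connectedin (weak_star K) (weak_star_nbhd K F e \<mu>0 \<inter> (A \<inter> prob_measures K))"
    (is "connectedin _ ?S")
proof (rule path_connectedin_imp_connectedin)
  have St: "?S \<subseteq> topspace (weak_star K)" by (auto simp: topspace_weak_star weak_star_nbhd_def)
  show "path_connectedin (weak_star K) ?S"
    unfolding path_connectedin_def path_connected_space_def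
  proof (intro conjI ballI St)
    fix \<mu> \<nu> assume "\<mu> \<in> topspace (subtopology (weak_star K) ?S)" "\<nu> \<in> topspace (subtopology (weak_star K) ?S)"
    then have S: "\<mu> \<in> ?S" "\<nu> \<in> ?S" by auto
    then have pos: "\<mu> \<in> pos_measures K" "\<nu> \<in> pos_measures K" using measure_coneD(1)[OF A] by auto
    let ?g = "\<lambda>t. comb (1 - t) \<mu> t \<nu>"
    have rad: "\<mu> \<in> topspace (weak_star K)" "\<nu> \<in> topspace (weak_star K)" using S St by blast+
    have "continuous_map (top_of_set {0..1}) (weak_star K) ?g"
      by (rule continuous_map_comb[OF K]) (use pos rad in \<open>auto intro!: continuous_intros\<close>)
    moreover have "?g t \<in> ?S" if t: "t \<in> {0..1}" for t
    proof -
      have g: "?g t \<in> A \<inter> prob_measures K"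
        using convex_combination_prob[OF A] S t by auto
      have "\<bar>signed_integral K (?g t) f - signed_integral K \<mu>0 f\<bar> < e" if f: "f \<in> F" for f
      proof -
        let ?i = "\<lambda>\<xi>. signed_integral K \<xi> f"
        have "?i (?g t) = (1 - t) * ?i \<mu> + t * ?i \<nu>"
          using signed_integral_comb[OF K(1) _ _ _ _ F[OF f], of \<mu> \<nu> "1 - t" t] pos t
          by (auto simp: pos_measures_iff)
        moreover have "?i \<mu> \<in> ball (?i \<mu>0) e" "?i \<nu> \<in> ball (?i \<mu>0) e"
          using S f by (auto simp: weak_star_nbhd_def dist_real_def abs_minus_commute)
        then have "(1 - t) *\<^sub>R ?i \<mu> + t *\<^sub>R ?i \<nu> \<in> ball (?i \<mu>0) e"
          using t by (intro convexD[OF convex_ball]) auto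
        ultimately show ?thesis by (simp add: dist_real_def abs_minus_commute)
      qed
      moreover have "?g t \<in> radon_measures K"
        using g measure_coneD(1)[OF A] by (auto simp: pos_measures_def)
      ultimately show ?thesis using g by (auto simp: weak_star_nbhd_def)
    qed
    ultimately have "pathin (subtopology (weak_star K) ?S) ?g"
      by (auto simp: pathin_def continuous_map_in_subtopology)
    moreover have "?g 0 = \<mu>" "?g 1 = \<nu>" by (auto simp: comb_def)
    ultimately show "\<exists>g. pathin (subtopology (weak_star K) ?S) g \<and> g 0 = \<mu> \<and> g 1 = \<nu>" by blast
  qed
qed

text \<open>Density and the connected traces of basic neighbourhoods are exactly what
  \<open>Cstar_embedded_imp_C_embedded\<close> requires.\<close>

lemma Cstar_embedded_prob_imp_C_embedded_prob:
  assumes A: "measure_cone K D A" and B: "measure_cone K D B"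
    and K: "compact_space K" "Hausdorff_space K"
    and D: "D \<subseteq> topspace K" "K closure_of D = topspace K"
    and Cs: "Cstar_embedded (subtopology (weak_star K) (B \<inter> prob_measures K)) (A \<inter> prob_measures K)"
  shows "C_embedded (subtopology (weak_star K) (B \<inter> prob_measures K)) (A \<inter> prob_measures K)"
    (is "C_embedded ?Z ?A")
proof (rule Cstar_embedded_imp_C_embedded[OF Cs])
  let ?B = "B \<inter> prob_measures K"
  have AB: "?A \<subseteq> ?B" using Cs by (simp add: Cstar_embedded_def measure_cone_topspace[OF B])
  have "?B \<inter> ?A = ?A" using AB by blast
  then show "?Z closure_of ?A = topspace ?Z"
    using closure_of_measure_cone(2)[OF A B K D]
    unfolding closure_of_subtopology measure_cone_topspace[OF B] by auto
  fix W z assume W: "openin ?Z W" "z \<in> W"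
  then obtain W' where W': "openin (weak_star K) W'" "W = W' \<inter> ?B"
    by (auto simp: openin_subtopology)
  obtain F e where F: "finite F" "\<And>f. f \<in> F \<Longrightarrow> continuous_map K euclideanreal f" "e > 0"
    "weak_star_nbhd K F e z \<subseteq> W'"
    using weak_star_nbhd_basis[OF W'(1), of z] W W' by (metis IntE)
  let ?N = "weak_star_nbhd K F e z"
  have "openin ?Z (?N \<inter> ?B)"
    using openin_weak_star_nbhd[OF F(1,2)] by (auto simp: openin_subtopology)
  moreover have "z \<in> ?N \<inter> ?B"
    using W W' F(3) openin_subset[OF W'(1)] by (auto simp: weak_star_nbhd_def topspace_weak_star)
  moreover have "connectedin ?Z (?N \<inter> ?B \<inter> ?A)"
  proof -
    have "?N \<inter> ?B \<inter> ?A = ?N \<inter> ?A" using AB by blast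
    then show ?thesis
      using connectedin_weak_star_nbhd_prob[OF A K F(2)] AB by (auto simp: connectedin_subtopology)
  qed
  ultimately show "\<exists>V. openin ?Z V \<and> z \<in> V \<and> V \<subseteq> W \<and> connectedin ?Z (V \<inter> ?A)"
    using F(4) W'(2) by (intro exI[of _ "?N \<inter> ?B"]) auto
qed

section \<open>Normalisation of mass and transfer of embeddings\<close>

text \<open>Where the mass of \<open>\<mu>\<close> is less than \<open>s\<close>, the missing mass is filled up with a multiple of \<open>\<nu>\<close>;
  this makes normalisation continuous on the whole cone, including at the zero measure.\<close>

definition normalize_measure ::
  "'b topology \<Rightarrow> real \<Rightarrow> ('b set \<Rightarrow> real) \<Rightarrow> ('b set \<Rightarrow> real) \<Rightarrow> 'b set \<Rightarrow> real" where
  "normalize_measure K s \<nu> \<mu> =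
     comb (1 / max s (\<mu> (topspace K))) \<mu> (max 0 (1 - \<mu> (topspace K) / s)) \<nu>"

lemma normalize_measure_eq:
  "0 < s \<Longrightarrow> s \<le> \<mu> (topspace K) \<Longrightarrow> normalize_measure K s \<nu> \<mu> = comb (1 / \<mu> (topspace K)) \<mu> 0 \<mu>"
  by (auto simp: normalize_measure_def comb_def max_def)

text \<open>With m the mass of \<open>\<mu>\<close>, the total is m/m + 0 when m is at least
  \<open>s\<close>, and m/s + (1 - m/s) when it is smaller; both equal 1.\<close>

lemma normalize_measure_in:
  assumes A: "measure_cone K D A" and s: "0 < s" and \<nu>: "\<nu> \<in> A \<inter> prob_measures K" and \<mu>: "\<mu> \<in> A"
  shows "normalize_measure K s \<nu> \<mu> \<in> A \<inter> prob_measures K"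
proof -
  have "\<nu> (topspace K) = 1" using \<nu> by (simp add: prob_measures_def)
  then have "normalize_measure K s \<nu> \<mu> (topspace K) = 1"
    using s by (auto simp: normalize_measure_def comb_def max_def field_simps)
  moreover have "normalize_measure K s \<nu> \<mu> \<in> A"
    unfolding normalize_measure_def using s \<nu> \<mu> by (intro measure_coneD(3)[OF A]) auto
  ultimately show ?thesis using measure_cone_prob_iff[OF A] by blast
qed

lemma continuous_map_normalize_measure:
  assumes A: "measure_cone K D A" and K: "compact_space K" "Hausdorff_space K"
    and s: "0 < s" and \<nu>: "\<nu> \<in> A \<inter> prob_measures K"
  shows "continuous_map (subtopology (weak_star K) A) (subtopology (weak_star K) (A \<inter> prob_measures K))
    (normalize_measure K s \<nu>)"
proof -
  let ?T = "subtopology (weak_star K) A"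
  have m: "continuous_map ?T euclideanreal (\<lambda>\<mu>. \<mu> (topspace K))"
    by (rule continuous_map_mass[OF measure_coneD(1)[OF A]])
  have \<nu>p: "\<nu> \<in> pos_measures K" using \<nu> measure_coneD(1)[OF A] by blast
  have "continuous_map ?T (weak_star K) (\<lambda>\<mu>. comb (1 / max s (\<mu> (topspace K))) \<mu> (max 0 (1 - \<mu> (topspace K) / s)) \<nu>)"
  proof (rule continuous_map_comb[OF K])
    show "continuous_map ?T (weak_star K) (\<lambda>\<mu>. \<mu>)"
      by (simp add: continuous_map_from_subtopology continuous_map_id[unfolded id_def])
    show "(\<lambda>\<mu>. \<mu>) \<in> topspace ?T \<rightarrow> pos_measures K" using measure_coneD(1)[OF A] by auto
    show "continuous_map ?T (weak_star K) (\<lambda>\<mu>. \<nu>)"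
      using \<nu>p by (auto simp: topspace_weak_star pos_measures_def)
    show "(\<lambda>\<mu>. \<nu>) \<in> topspace ?T \<rightarrow> pos_measures K" using \<nu>p by auto
    show "continuous_map ?T euclideanreal (\<lambda>\<mu>. 1 / max s (\<mu> (topspace K)))"
      using s by (intro continuous_map_real_divide continuous_map_real_max m) auto
    show "continuous_map ?T euclideanreal (\<lambda>\<mu>. max 0 (1 - \<mu> (topspace K) / s))"
      using s by (intro continuous_map_real_max continuous_map_diff continuous_map_real_divide m) auto
  qed (use s in auto)
  then show ?thesis
    using normalize_measure_in[OF A s \<nu>] unfolding continuous_map_in_subtopology normalize_measure_def[symmetric]
    by auto
qed

text \<open>With threshold 1, normalisation fixes every probability measure and so retracts
  \<open>A\<close> onto its probability measures. A function on these is composed with the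
  retraction, extended to \<open>B\<close>, and restricted again.\<close>

lemma embedded_pos_imp_prob:
  assumes A: "measure_cone K D A" and B: "measure_cone K D B"
    and K: "compact_space K" "Hausdorff_space K"
  shows "C_embedded (subtopology (weak_star K) B) A \<Longrightarrow>
      C_embedded (subtopology (weak_star K) (B \<inter> prob_measures K)) (A \<inter> prob_measures K)"
    and "Cstar_embedded (subtopology (weak_star K) B) A \<Longrightarrow>
      Cstar_embedded (subtopology (weak_star K) (B \<inter> prob_measures K)) (A \<inter> prob_measures K)"
proof -
  let ?A1 = "A \<inter> prob_measures K" and ?B1 = "B \<inter> prob_measures K"
  \<comment> \<open>The range condition on \<open>h\<close> preserves boundedness, so one extension
    statement serves both kinds of embedding.\<close>
  have ext: "\<exists>g. continuous_map (subtopology (weak_star K) ?B1) euclideanreal g \<and> (\<forall>x\<in>?A1. g x = f x)"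
    if AB: "A \<subseteq> B" and f: "continuous_map (subtopology (subtopology (weak_star K) ?B1) ?A1) euclideanreal f"
      and emb: "\<And>h. \<lbrakk>continuous_map (subtopology (weak_star K) A) euclideanreal h; h ` A \<subseteq> f ` ?A1\<rbrakk> \<Longrightarrow>
        \<exists>g. continuous_map (subtopology (weak_star K) B) euclideanreal g \<and> (\<forall>x\<in>A. g x = h x)" for f
  proof (cases "?A1 = {}")
    \<comment> \<open>Without a probability measure in \<open>A\<close> there is no filler for the
      normalisation, but then any continuous function will do.\<close>
    case True
    then show ?thesis by (intro exI[of _ "\<lambda>_. 0"]) auto
  next
    case False
    then obtain \<nu> where \<nu>: "\<nu> \<in> ?A1" by blast
    have "?B1 \<inter> ?A1 = ?A1" using AB by blast
    then have f': "continuous_map (subtopology (weak_star K) ?A1) euclideanreal f"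
      using f by (simp add: subtopology_subtopology)
    let ?\<rho> = "normalize_measure K 1 \<nu>"
    have "continuous_map (subtopology (weak_star K) A) euclideanreal (f \<circ> ?\<rho>)"
      using continuous_map_compose[OF continuous_map_normalize_measure[OF A K _ \<nu>] f', of 1] by simp
    moreover have "(f \<circ> ?\<rho>) ` A \<subseteq> f ` ?A1"
      using normalize_measure_in[OF A _ \<nu>, of 1] by auto
    ultimately obtain g where g: "continuous_map (subtopology (weak_star K) B) euclideanreal g"
      "\<And>x. x \<in> A \<Longrightarrow> g x = f (?\<rho> x)"
      using emb[of "f \<circ> ?\<rho>"] by auto
    have "continuous_map (subtopology (weak_star K) ?B1) euclideanreal g"
      using g(1) by (rule continuous_map_from_subtopology_mono) auto
    moreover have "g \<mu> = f \<mu>" if "\<mu> \<in> ?A1" for \<mu>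
      using g(2)[of \<mu>] that normalize_measure_eq[of 1 \<mu> K \<nu>] by (auto simp: prob_measures_def)
    ultimately show ?thesis by blast
  qed
  note ts = measure_cone_topspace[OF B]
  show "C_embedded (subtopology (weak_star K) ?B1) ?A1" if C: "C_embedded (subtopology (weak_star K) B) A"
  proof -
    have AB: "A \<subseteq> B" using C by (simp add: C_embedded_def ts)
    then have "B \<inter> A = A" by blast
    then show ?thesis
      using C AB ext[OF AB] unfolding C_embedded_def ts by (auto simp: subtopology_subtopology)
  qed
  show "Cstar_embedded (subtopology (weak_star K) ?B1) ?A1" if C: "Cstar_embedded (subtopology (weak_star K) B) A"
  proof -
    have AB: "A \<subseteq> B" using C by (simp add: Cstar_embedded_def ts)
    then have BA: "B \<inter> A = A" by blast
    show ?thesis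
      unfolding Cstar_embedded_def ts
    proof (intro conjI allI impI)
      fix f assume f: "continuous_map (subtopology (subtopology (weak_star K) ?B1) ?A1) euclideanreal f \<and> bounded (f ` ?A1)"
      show "\<exists>g. continuous_map (subtopology (weak_star K) ?B1) euclideanreal g \<and> (\<forall>x\<in>?A1. g x = f x)"
      proof (rule ext[OF AB])
        fix h assume h: "continuous_map (subtopology (weak_star K) A) euclideanreal h" "h ` A \<subseteq> f ` ?A1"
        then have "bounded (h ` A)" using f bounded_subset by blast
        then show "\<exists>g. continuous_map (subtopology (weak_star K) B) euclideanreal g \<and> (\<forall>x\<in>A. g x = h x)"
          using C h(1) unfolding Cstar_embedded_def by (simp add: subtopology_subtopology BA)
      qed (use f in simp)
    qed (use AB in auto)
  qed
qed

text \<open>It suffices to find a limit of \<open>f\<close> at each \<open>z\<close> in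
  \<open>B - A\<close>. In the coordinates mass and normalised measure, \<open>f\<close> near
  \<open>z\<close> becomes a function of \<open>t\<close> near the mass of \<open>z\<close> and of
  \<open>\<nu>\<close> near the normalisation of \<open>z\<close>. By
  \<open>C_embedded_uniform_limit\<close> it converges uniformly in \<open>t\<close> as
  \<open>\<nu>\<close> approaches that normalisation, and the limit of \<open>f\<close> at
  \<open>z\<close> is the limit function evaluated at the mass of \<open>z\<close>.\<close>

lemma C_embedded_prob_imp_pos:
  assumes A: "measure_cone K D A" and B: "measure_cone K D B"
    and K: "compact_space K" "Hausdorff_space K"
    and D: "D \<subseteq> topspace K" "K closure_of D = topspace K"
    and C: "C_embedded (subtopology (weak_star K) (B \<inter> prob_measures K)) (A \<inter> prob_measures K)"
  shows "C_embedded (subtopology (weak_star K) B) A"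
proof -
  let ?W = "weak_star K" and ?N = "\<lambda>\<mu>. \<mu> (topspace K)"
  let ?A1 = "A \<inter> prob_measures K" and ?B1 = "B \<inter> prob_measures K"
  let ?Z = "subtopology ?W ?B1"
  note ts = measure_cone_topspace[OF B]
  have AB1: "?A1 \<subseteq> ?B1" using C by (simp add: C_embedded_def ts)
  have N0: "0 \<le> ?N \<mu>" "?N \<mu> = 0 \<Longrightarrow> \<mu> = (\<lambda>_. 0)" if \<mu>: "\<mu> \<in> pos_measures K" for \<mu>
  proof -
    have ps: "pos_signed_measure K \<mu>" using \<mu> by (simp add: pos_measures_iff)
    then show "0 \<le> ?N \<mu>" by (simp add: pos_signed_measure_def)
    assume 0: "?N \<mu> = 0"
    show "\<mu> = (\<lambda>_. 0)"
    proof
      fix E show "\<mu> E = 0"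
      proof (cases "E \<in> borel_sets K")
        case True
        then show ?thesis
          using pos_signed_measure_mono[OF ps True borel_sets_topspace borel_sets_subset] ps 0
          by (simp add: pos_signed_measure_def order_antisym)
      next
        case False
        then show ?thesis using ps by (simp add: pos_signed_measure_def signed_measure_def)
      qed
    qed
  qed
  \<comment> \<open>A combination \<open>comb c \<mu> 0 \<mu>\<close> is the scalar multiple of
    \<open>\<mu>\<close> by \<open>c\<close>; \<open>unit\<close> divides by the mass and
    \<open>rescale\<close> undoes this.\<close>
  have unit: "comb (1 / ?N \<mu>) \<mu> 0 \<mu> \<in> E \<inter> prob_measures K"
    if E: "measure_cone K D E" and \<mu>: "\<mu> \<in> E" "0 < ?N \<mu>" for E \<mu>
    using measure_coneD(3)[OF E \<mu>(1) \<mu>(1)] \<mu>(2) unfolding measure_cone_prob_iff[OF E]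
    by (simp add: comb_apply)
  have rescale: "comb (?N \<mu>) (comb (1 / ?N \<mu>) \<mu> 0 \<mu>) 0 (comb (1 / ?N \<mu>) \<mu> 0 \<mu>) = \<mu>" if "0 < ?N \<mu>" for \<mu>
    using that by (simp add: comb_def)
  \<comment> \<open>Inclusion of the cones follows from that of the probability measures by scaling,
    except at the zero measure, which lies in every measure cone.\<close>
  have AB: "A \<subseteq> B"
  proof
    fix \<mu> assume \<mu>: "\<mu> \<in> A"
    show "\<mu> \<in> B"
    proof (cases "?N \<mu> = 0")
      case True
      then show ?thesis using N0(2)[of \<mu>] \<mu> measure_coneD(1)[OF A] measure_coneD(2)[OF B] by auto
    next
      case False
      then have N: "0 < ?N \<mu>" using N0(1)[of \<mu>] \<mu> measure_coneD(1)[OF A] by force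
      have "comb (1 / ?N \<mu>) \<mu> 0 \<mu> \<in> B" using unit[OF A \<mu> N] AB1 by blast
      then show ?thesis using measure_coneD(3)[OF B] N rescale[of \<mu>, OF N] by (metis less_imp_le order_refl)
    qed
  qed
  have BA1: "?B1 \<inter> ?A1 = ?A1" using AB1 by blast
  have dense1: "?Z closure_of ?A1 = topspace ?Z"
    using closure_of_measure_cone(2)[OF A B K D] BA1
    unfolding closure_of_subtopology ts by auto
  have subA: "subtopology ?Z ?A1 = subtopology ?W ?A1"
    by (simp add: subtopology_subtopology BA1)
  show ?thesis
    unfolding C_embedded_def ts
  proof (intro conjI allI impI AB)
    fix f assume "continuous_map (subtopology (subtopology ?W B) A) euclideanreal f"
    then have f: "continuous_map (subtopology ?W A) euclideanreal f"
      using AB by (simp add: subtopology_subtopology inf.absorb2)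
    have lim: "\<exists>l. limitin euclideanreal f l (atin_within ?W z A)" if z: "z \<in> B - A" for z
    proof -
      define r where "r = ?N z"
      \<comment> \<open>If the mass were 0, then \<open>z\<close> would be the zero measure and
        hence belong to \<open>A\<close>.\<close>
      have r: "0 < r"
        using N0[of z] z measure_coneD(1)[OF B] measure_coneD(2)[OF A] unfolding r_def
        by (metis DiffD1 DiffD2 order_le_less subsetD)
      define z1 where "z1 = comb (1 / r) z 0 z"
      have z1: "z1 \<in> ?B1" using unit[OF B, of z] z r by (simp add: z1_def r_def)
      \<comment> \<open>A compact interval with \<open>r\<close> in its interior and away from
        0.\<close>
      let ?S = "{r/2..2*r}"
      define F where "F \<nu> t = f (comb t \<nu> 0 \<nu>)" for \<nu> t
      have "continuous_map (prod_topology (subtopology ?Z ?A1) (top_of_set ?S)) euclideanreal (\<lambda>(\<nu>, t). F \<nu> t)"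
      proof -
        let ?P = "prod_topology (subtopology ?W ?A1) (top_of_set ?S)"
        have tP: "topspace ?P = ?A1 \<times> ?S"
          using measure_cone_topspace(2)[OF A] by simp
        have fst: "continuous_map ?P ?W fst"
          using continuous_map_fst continuous_map_in_subtopology by blast
        have snd: "continuous_map ?P euclideanreal snd"
          using continuous_map_snd continuous_map_in_subtopology by blast
        have "continuous_map ?P ?W (\<lambda>p. comb (snd p) (fst p) 0 (fst p))"
          by (rule continuous_map_comb[OF K fst _ fst _ snd])
            (use tP measure_coneD(1)[OF A] r in auto)
        moreover have "comb (snd p) (fst p) 0 (fst p) \<in> A" if "p \<in> topspace ?P" for p
          using that r unfolding tP by (intro measure_coneD(3)[OF A]) auto
        ultimately have "continuous_map ?P (subtopology ?W A) (\<lambda>p. comb (snd p) (fst p) 0 (fst p))"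
          by (auto simp: continuous_map_in_subtopology)
        from continuous_map_compose[OF this f] show ?thesis
          by (simp add: subA F_def o_def case_prod_unfold)
      qed
      then obtain \<phi> where \<phi>: "continuous_on ?S \<phi>"
        "\<And>e. e > 0 \<Longrightarrow> \<exists>U. openin ?Z U \<and> z1 \<in> U \<and> (\<forall>a\<in>U \<inter> ?A1. \<forall>t\<in>?S. \<bar>F a t - \<phi> t\<bar> < e)"
        using C_embedded_uniform_limit[OF C dense1, of ?S F z1] z1 r ts by auto
      have "limitin euclideanreal f (\<phi> r) (atin_within ?W z A)"
        unfolding limitin_canonical_iff
      proof (rule tendstoI)
        fix e :: real assume e: "e > 0"
        obtain U where U: "openin ?Z U" "z1 \<in> U" "\<And>a t. a \<in> U \<inter> ?A1 \<Longrightarrow> t \<in> ?S \<Longrightarrow> \<bar>F a t - \<phi> t\<bar> < e/2"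
          using \<phi>(2)[of "e/2"] e by auto
        obtain d where d: "d > 0" "\<And>t. t \<in> ?S \<Longrightarrow> dist t r < d \<Longrightarrow> dist (\<phi> t) (\<phi> r) < e/2"
          using \<phi>(1) r e unfolding continuous_on_iff by (metis atLeastAtMost_iff half_gt_zero
              less_imp_le field_sum_of_halves le_add_same_cancel1 mult_2)
        \<comment> \<open>With threshold \<open>r/2\<close> the map is continuous on all of
          \<open>B\<close>, and it is exact division by the mass on the measures whose mass lies in
          \<open>?I\<close>.\<close>
        let ?\<rho> = "normalize_measure K (r/2) z1"
        let ?I = "{r/2<..<2*r} \<inter> ball r d"
        let ?V = "{\<mu> \<in> topspace (subtopology ?W B). ?N \<mu> \<in> ?I} \<inter> {\<mu> \<in> topspace (subtopology ?W B). ?\<rho> \<mu> \<in> U}"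
        have "openin (subtopology ?W B) ?V"
        proof (rule openin_Int)
          show "openin (subtopology ?W B) {\<mu> \<in> topspace (subtopology ?W B). ?N \<mu> \<in> ?I}"
            by (rule openin_continuous_map_preimage[OF continuous_map_mass[OF measure_coneD(1)[OF B]]])
              (simp add: open_Int)
          show "openin (subtopology ?W B) {\<mu> \<in> topspace (subtopology ?W B). ?\<rho> \<mu> \<in> U}"
            by (rule openin_continuous_map_preimage[OF continuous_map_normalize_measure[OF B K _ z1] U(1)])
              (use r in simp)
        qed
        then obtain V where V: "openin ?W V" "?V = V \<inter> B" by (auto simp: openin_subtopology)
        have \<rho>: "?\<rho> \<mu> = comb (1 / ?N \<mu>) \<mu> 0 \<mu>" if "?N \<mu> \<in> ?I" for \<mu>
          using that r by (intro normalize_measure_eq) auto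
        have "z \<in> ?V"
        proof -
          have "z \<in> topspace (subtopology ?W B)" using z unfolding ts by blast
          moreover have I: "?N z \<in> ?I" using r d(1) by (simp add: r_def[symmetric])
          moreover have "?\<rho> z = z1" unfolding \<rho>[of z, OF I] by (simp add: z1_def r_def)
          ultimately show ?thesis using U(2) by simp
        qed
        then have "z \<in> V" using V by blast
        \<comment> \<open>The value \<open>f x\<close> is within \<open>e/2\<close> of
          \<open>\<phi>\<close> at the mass of \<open>x\<close> by uniform convergence, and this in
          turn is within \<open>e/2\<close> of \<open>\<phi> r\<close> by continuity of
          \<open>\<phi>\<close>.\<close>
        moreover have "dist (f x) (\<phi> r) < e" if x: "x \<in> V" "x \<in> A" for x
        proof -
          have "x \<in> ?V" using x V AB by blast
          then have N: "?N x \<in> ?I" and \<rho>U: "?\<rho> x \<in> U" by auto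
          have pos: "0 < ?N x" using N r by auto
          have "?\<rho> x \<in> U \<inter> ?A1" using \<rho>U \<rho>[of x, OF N] unit[OF A x(2) pos] by simp
          moreover have S: "?N x \<in> ?S" using N by auto
          ultimately have "\<bar>F (?\<rho> x) (?N x) - \<phi> (?N x)\<bar> < e/2" using U(3) by blast
          moreover have "F (?\<rho> x) (?N x) = f x" using rescale[of x, OF pos] \<rho>[of x, OF N] by (simp add: F_def)
          moreover have "dist (\<phi> (?N x)) (\<phi> r) < e/2" using N by (intro d(2)[OF S]) (simp add: dist_commute)
          ultimately show ?thesis unfolding dist_real_def by linarith
        qed
        ultimately show "\<forall>\<^sub>F x in atin_within ?W z A. dist (f x) (\<phi> r) < e"
          unfolding eventually_atin_within using V(1) by blast
      qed
      then show ?thesis by blast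
    qed
    \<comment> \<open>Limits at the points of \<open>B - A\<close> give a continuous extension to
      \<open>B\<close>, because \<open>A\<close> is dense in \<open>B\<close> and the real line is
      regular.\<close>
    obtain g where "continuous_map (subtopology ?W B) euclideanreal g" "\<And>x. x \<in> A \<Longrightarrow> g x = f x"
      by (rule continuous_map_extension_pointwise_alt[OF _ AB closure_of_measure_cone(1)[OF A B K D] f lim])
        (simp_all add: metrizable_imp_regular_space metrizable_space_euclidean)
    then show "\<exists>g. continuous_map (subtopology ?W B) euclideanreal g \<and> (\<forall>x\<in>A. g x = f x)" by blast
  qed
qed

section \<open>Classes of measures on a topological space\<close>

lemma stone_cech_compact_Hausdorff: "compact_space (stone_cech X)" "Hausdorff_space (stone_cech X)"
proof -
  have "compact_space (top_of_set {0..1::real})" by (rule compact_space_subtopology) simp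
  then have c: "compact_space (unit_cube X)"
    unfolding unit_cube_def compact_space_product_topology by blast
  show "compact_space (stone_cech X)"
    unfolding stone_cech_def
    by (intro compact_space_subtopology closedin_compact_space[OF c] closedin_closure_of)
  show "Hausdorff_space (stone_cech X)"
    unfolding stone_cech_def unit_cube_def
    by (intro Hausdorff_space_subtopology) (simp add: Hausdorff_space_product_topology Hausdorff_space_subtopology)
qed

lemma sc_embed_dense:
  "sc_embed X ` topspace X \<subseteq> topspace (stone_cech X)"
  "stone_cech X closure_of (sc_embed X ` topspace X) = topspace (stone_cech X)"
proof -
  let ?D = "sc_embed X ` topspace X"
  have sub: "?D \<subseteq> topspace (unit_cube X)"
  proof
    fix y assume "y \<in> ?D"
    then obtain x where x: "x \<in> topspace X" "y = sc_embed X x" by blast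
    have "f x \<in> {0..1}" if "f \<in> unit_functions X" for f
    proof -
      have "continuous_map X (top_of_set {0..1}) f" using that by (simp add: unit_functions_def)
      from continuous_map_funspace[OF this] show ?thesis using x(1) by auto
    qed
    then show "y \<in> topspace (unit_cube X)"
      by (simp add: x(2) sc_embed_def unit_cube_def)
  qed
  then have cl: "?D \<subseteq> unit_cube X closure_of ?D" by (rule closure_of_subset)
  have ts: "topspace (stone_cech X) = unit_cube X closure_of ?D"
    using closure_of_subset_topspace[of "unit_cube X"] by (auto simp: stone_cech_def)
  show "?D \<subseteq> topspace (stone_cech X)" using cl ts by simp
  show "stone_cech X closure_of ?D = topspace (stone_cech X)"
    unfolding ts using cl by (simp add: stone_cech_def closure_of_subtopology inf.absorb2)
qed

text \<open>One sufficient condition for all six classes, meant for the zero measure and the point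
  masses: a finite set is at once compact, sigma-compact and countable, and nullity outside the
  image of \<open>X\<close> settles the classes sigma and tau.\<close>

lemma class_measuresI:
  assumes \<mu>: "\<mu> \<in> radon_measures (stone_cech X)"
    and S: "finite S" "S \<subseteq> topspace X" "concentrated_on (stone_cech X) \<mu> (sc_embed X ` S)"
    and null: "\<And>C. C \<subseteq> topspace (stone_cech X) - sc_embed X ` topspace X \<Longrightarrow>
      total_variation (stone_cech X) \<mu> C = 0"
  shows "\<mu> \<in> class_measures p X"
proof -
  have "compactin X S" using S by (intro finite_imp_compactin) auto
  moreover from this have "sigma_compact_in X S"
    unfolding sigma_compact_in_def by (intro exI[of _ "\<lambda>_. S"]) auto
  moreover have "countable S" using S(1) by (rule countable_finite)
  ultimately show ?thesis
    using \<mu> S(2,3) null by (cases p) (simp_all, blast+)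
qed

text \<open>A set that is null for two measures is null for their nonnegative combinations, which
  settles the classes sigma and tau. For the classes R, beta and d the combination is concentrated
  on the union of the two concentrating sets, and sigma-compact, compact and countable sets are
  closed under finite unions.\<close>

lemma measure_cone_class_pos:
  "measure_cone (stone_cech X) (sc_embed X ` topspace X) (class_pos p X)"
proof -
  let ?K = "stone_cech X" and ?D = "sc_embed X ` topspace X"
  note K = stone_cech_compact_Hausdorff[of X]
  have tv: "total_variation ?K \<mu> E = 0 \<longleftrightarrow> (\<forall>A\<in>borel_sets ?K. A \<subseteq> E \<longrightarrow> \<mu> A = 0)"
    if "\<mu> \<in> pos_measures ?K" for \<mu> E
    using that by (intro total_variation_eq_0_iff) (simp add: pos_measures_iff)
  have rad: "\<mu> \<in> pos_measures ?K \<Longrightarrow> \<mu> \<in> radon_measures ?K" for \<mu> by (simp add: pos_measures_def)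
  have zero: "(\<lambda>_. 0) \<in> class_pos p X"
  proof -
    note z = zero_pos_measures[OF K(2)]
    have "total_variation ?K (\<lambda>_. 0) E = 0" for E unfolding tv[OF z] by simp
    then have "(\<lambda>_. 0) \<in> class_measures p X"
      by (intro class_measuresI[where S="{}"] rad[OF z]) (simp_all add: concentrated_on_def)
    with z show ?thesis by (simp add: class_pos_def)
  qed
  have dirac: "dirac ?K (sc_embed X x) \<in> class_pos p X" if x: "x \<in> topspace X" for x
  proof -
    have xK: "sc_embed X x \<in> topspace ?K" by (rule subsetD[OF sc_embed_dense(1)]) (rule imageI[OF x])
    note d = dirac_pos_measures[OF K(2) xK]
    have null: "total_variation ?K (dirac ?K (sc_embed X x)) E = 0" if "sc_embed X x \<notin> E" for E
      unfolding tv[OF d] using that by (auto simp: dirac_def)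
    have "dirac ?K (sc_embed X x) \<in> class_measures p X"
    proof (rule class_measuresI[where S="{x}", OF rad[OF d]])
      show "concentrated_on ?K (dirac ?K (sc_embed X x)) (sc_embed X ` {x})"
        unfolding concentrated_on_def by (rule null) simp
      show "total_variation ?K (dirac ?K (sc_embed X x)) C = 0" if "C \<subseteq> topspace ?K - ?D" for C
        by (rule null) (use that x in blast)
    qed (use x in simp_all)
    with d show ?thesis by (simp add: class_pos_def)
  qed
  have comb: "comb a \<mu> b \<nu> \<in> class_pos p X"
    if \<mu>: "\<mu> \<in> class_pos p X" and \<nu>: "\<nu> \<in> class_pos p X" and ab: "0 \<le> a" "0 \<le> b" for \<mu> \<nu> a b
  proof -
    have pos: "\<mu> \<in> pos_measures ?K" "\<nu> \<in> pos_measures ?K" using \<mu> \<nu> by (auto simp: class_pos_def)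
    note c = pos_measures_comb[OF K(2) pos ab]
    have null: "total_variation ?K (comb a \<mu> b \<nu>) E = 0"
      if "total_variation ?K \<mu> E1 = 0" "total_variation ?K \<nu> E2 = 0" "E \<subseteq> E1" "E \<subseteq> E2" for E E1 E2
      using that unfolding tv[OF c] tv[OF pos(1)] tv[OF pos(2)] by (simp add: comb_def)
    have null0: "total_variation ?K (comb a \<mu> b \<nu>) E = 0"
      if "total_variation ?K \<mu> E = 0" "total_variation ?K \<nu> E = 0" for E
      using null that by blast
    have conc: "concentrated_on ?K (comb a \<mu> b \<nu>) (sc_embed X ` (S \<union> T))"
      if "concentrated_on ?K \<mu> (sc_embed X ` S)" "concentrated_on ?K \<nu> (sc_embed X ` T)" for S T
      using that unfolding concentrated_on_def by (rule null) auto
    have sc: "sigma_compact_in X (S \<union> T)" if S: "sigma_compact_in X S" and T: "sigma_compact_in X T" for S T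
    proof -
      obtain C where C: "\<And>n. compactin X (C n)" "S = (\<Union>n::nat. C n)"
        using S unfolding sigma_compact_in_def by blast
      obtain C' where C': "\<And>n. compactin X (C' n)" "T = (\<Union>n::nat. C' n)"
        using T unfolding sigma_compact_in_def by blast
      show ?thesis unfolding sigma_compact_in_def
        using C C' by (intro exI[of _ "\<lambda>n. C n \<union> C' n"]) (auto intro: compactin_Un)
    qed
    have "comb a \<mu> b \<nu> \<in> class_measures p X"
    proof (cases p)
      case Class_a
      then show ?thesis using rad[OF c] by simp
    next
      case Class_sigma
      then show ?thesis using rad[OF c] \<mu> \<nu> null0 by (simp add: class_pos_def)
    next
      case Class_tau
      then show ?thesis using rad[OF c] \<mu> \<nu> null0 by (simp add: class_pos_def)
    next
      case Class_R
      then obtain S T where "sigma_compact_in X S" "concentrated_on ?K \<mu> (sc_embed X ` S)"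
        "sigma_compact_in X T" "concentrated_on ?K \<nu> (sc_embed X ` T)"
        using \<mu> \<nu> by (auto simp: class_pos_def)
      then have "sigma_compact_in X (S \<union> T) \<and> concentrated_on ?K (comb a \<mu> b \<nu>) (sc_embed X ` (S \<union> T))"
        using sc conc by blast
      then show ?thesis using rad[OF c] Class_R by auto
    next
      case Class_beta
      then obtain S T where "compactin X S" "concentrated_on ?K \<mu> (sc_embed X ` S)"
        "compactin X T" "concentrated_on ?K \<nu> (sc_embed X ` T)"
        using \<mu> \<nu> by (auto simp: class_pos_def)
      then have "compactin X (S \<union> T) \<and> concentrated_on ?K (comb a \<mu> b \<nu>) (sc_embed X ` (S \<union> T))"
        using compactin_Un conc by blast
      then show ?thesis using rad[OF c] Class_beta by auto
    next
      case Class_d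
      then obtain S T where "countable S" "S \<subseteq> topspace X" "concentrated_on ?K \<mu> (sc_embed X ` S)"
        "countable T" "T \<subseteq> topspace X" "concentrated_on ?K \<nu> (sc_embed X ` T)"
        using \<mu> \<nu> by (auto simp: class_pos_def)
      then have "countable (S \<union> T) \<and> S \<union> T \<subseteq> topspace X \<and>
          concentrated_on ?K (comb a \<mu> b \<nu>) (sc_embed X ` (S \<union> T))"
        using conc by blast
      then show ?thesis using rad[OF c] Class_d by auto
    qed
    then show ?thesis using c by (simp add: class_pos_def)
  qed
  show ?thesis
    unfolding measure_cone_def using zero dirac comb by (auto simp: class_pos_def)
qed

theorem theorem4:
  fixes X :: "'a topology" and p q :: measure_class
  assumes "completely_regular_space X" and "Hausdorff_space X"
  shows "(universally_P_measurable p q X \<longleftrightarrow> universally_Mpos_measurable p q X) \<and>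
         (universally_Pstar_measurable p q X \<longleftrightarrow> universally_Mposstar_measurable p q X)"
proof -
  let ?K = "stone_cech X"
  note cones = measure_cone_class_pos[of X p] measure_cone_class_pos[of X q]
  note K = stone_cech_compact_Hausdorff[of X] and D = sc_embed_dense[of X]
  have prob: "class_prob r X = class_pos r X \<inter> prob_measures ?K" for r
    by (auto simp: class_prob_def class_pos_def prob_measures_def)
  have C: "C_embedded (subtopology (weak_star ?K) (class_prob q X)) (class_prob p X) \<longleftrightarrow>
      C_embedded (subtopology (weak_star ?K) (class_pos q X)) (class_pos p X)"
    unfolding prob using embedded_pos_imp_prob(1)[OF cones K] C_embedded_prob_imp_pos[OF cones K D] by blast
  \<comment> \<open>From probability measures to cones the C*-case passes through C-embeddings:
    first upgrade the C*-embedding of the probability measures, then transfer it to the cones, and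
    finally weaken it again.\<close>
  have "Cstar_embedded (subtopology (weak_star ?K) (class_prob q X)) (class_prob p X) \<longleftrightarrow>
      Cstar_embedded (subtopology (weak_star ?K) (class_pos q X)) (class_pos p X)"
    unfolding prob
    using embedded_pos_imp_prob(2)[OF cones K] C_embedded_prob_imp_pos[OF cones K D]
      Cstar_embedded_prob_imp_C_embedded_prob[OF cones K D] C_embedded_imp_Cstar_embedded by blast
  with C show ?thesis
    unfolding universally_P_measurable_def universally_Mpos_measurable_def
      universally_Pstar_measurable_def universally_Mposstar_measurable_def by blast
qed

end
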